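(* Let $\mathbb{K}$ be a field of characteristic zero, $S=\mathbb{K}[x,y,z]$, $\alpha\in\mathbb{K}$ with $\alpha\neq 0,1$, and let $X_3$ be the arrangement of the six planes $H_1,\dots,H_6$ defined by $x,\ y,\ z,\ x-\alpha y,\ x+z,\ y+z$ respectively, with positive integer multiplicities $\mathbf{m}=[m_1,\dots,m_6]$. Let $\mathcal{J}=(\mathcal{J}_1\xrightarrow{\delta^1}\mathcal{J}_2)$ be the two-term complex defined in the context. Then $D(X_3,\mathbf{m})$ is a free $S$-module if and only if $H^2(\mathcal{J})=0$, where $H^2(\mathcal{J})=\mathrm{coker}(\delta^1:\mathcal{J}_1\to\mathcal{J}_2)$.
   Context: Write $\alpha_1=x,\ \alpha_2=y,\ \alpha_3=z,\ \alpha_4=x-\alpha y,\ \alpha_5=x+z,\ \alpha_6=y+z$, so $H_i=\{\alpha_i=0\}$ and $m_i=\mathbf{m}(H_i)$. The module of derivations is $$D(X_3,\mathbf{m})=\{\theta\in\mathrm{Der}(S):\theta(\alpha_i)\in\alpha_i^{m_i}S \text{ for } 1\le i\le 6\},$$ where $\mathrm{Der}(S)$ is the $S$-module of $\mathbb{K}$-linear derivations of $S$. The triple points of $X_3$ are the codimension-two flats $Y_1=H_1\cap H_2\cap H_4$, $Y_2=H_1\cap H_3\cap H_5$, $Y_3=H_2\cap H_3\cap H_6$. Define the ideals $J(H_i)=\alpha_i^{m_i}S$, and for each triple point $Y$, $J(Y)=\sum_{H_i\supset Y}J(H_i)$; so $J(Y_1)=\langle x^{m_1},y^{m_2},(x-\alpha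 y)^{m_4}\rangle$, $J(Y_2)=\langle x^{m_1},z^{m_3},(x+z)^{m_5}\rangle$, $J(Y_3)=\langle y^{m_2},z^{m_3},(y+z)^{m_6}\rangle$. Let $\mathcal{J}_1=\bigoplus_{i=1}^6J(H_i)\subset S^6$ and $\mathcal{J}_2=J(Y_1)\oplus J(Y_2)\oplus J(Y_3)\subset S^3$, and let $\delta^1:\mathcal{J}_1\to\mathcal{J}_2$ be the restriction of the map $S^6\to S^3$ given by the matrix $$\delta^1=\begin{bmatrix}1&-\alpha&0&-1&0&0\\ 1&0&1&0&-1&0\\ 0&1&1&0&0&-1\end{bmatrix}$$ (columns indexed by $H_1,\dots,H_6$, rows by $Y_1,Y_2,Y_3$). The complex $\mathcal{J}$ has $\mathcal{J}_1$ in cohomological degree 1 and $\mathcal{J}_2$ in cohomological degree 2, and zero elsewhere. *)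

theory Defs
  imports
    "HOL-Computational_Algebra.Computational_Algebra"
    "HOL-Library.Function_Algebras"
begin

section \<open>The polynomial ring\<close>

text \<open>
  The ring \<open>S = K[x,y,z]\<close> is the iterated polynomial ring \<open>K[x][y][z]\<close>: the outermost
  \<open>poly\<close> carries the variable \<open>z\<close>, the innermost one the variable \<open>x\<close>.
\<close>

type_synonym 'a S = "'a poly poly poly"

definition cS :: "'a::field_char_0 \<Rightarrow> 'a S"
  where "cS c = [:[:[:c:]:]:]"

definition xS :: "'a::field_char_0 S"
  where "xS = [:[:[:0, 1:]:]:]"

definition yS :: "'a::field_char_0 S"
  where "yS = [:[:0, 1:]:]"

definition zS :: "'a::field_char_0 S"
  where "zS = [:0, 1:]"

definition evalS :: "'a::field_char_0 S \<Rightarrow> 'a \<times> 'a \<times> 'a \<Rightarrow> 'a"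
  where "evalS p = (\<lambda>(u, v, w). poly (poly (poly p [:[:w:]:]) [:v:]) u)"

lemma evalS_simps [simp]:
  "evalS (cS c) (u, v, w) = c"
  "evalS xS (u, v, w) = u"
  "evalS yS (u, v, w) = v"
  "evalS zS (u, v, w) = w"
  "evalS (p + q) P = evalS p P + evalS q P"
  "evalS (p - q) P = evalS p P - evalS q P"
  "evalS (p * q) P = evalS p P * evalS q P"
  by (auto simp: evalS_def cS_def xS_def yS_def zS_def split: prod.splits)


section \<open>The arrangement and its triple points\<close>

datatype plane = H1 | H2 | H3 | H4 | H5 | H6

datatype triple_point = Y1 | Y2 | Y3

lemma UNIV_plane: "UNIV = {H1, H2, H3, H4, H5, H6}"
  using plane.exhaust by auto

lemma UNIV_triple_point: "UNIV = {Y1, Y2, Y3}"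
  using triple_point.exhaust by auto

instance plane :: finite
  by standard (simp add: UNIV_plane)

instance triple_point :: finite
  by standard (simp add: UNIV_triple_point)

fun lform :: "'a::field_char_0 \<Rightarrow> plane \<Rightarrow> 'a S"
  where
    "lform a H1 = xS"
  | "lform a H2 = yS"
  | "lform a H3 = zS"
  | "lform a H4 = xS - cS a * yS"
  | "lform a H5 = xS + zS"
  | "lform a H6 = yS + zS"

definition plane_set :: "'a::field_char_0 \<Rightarrow> plane \<Rightarrow> ('a \<times> 'a \<times> 'a) set"
  where "plane_set a H = {v. evalS (lform a H) v = 0}"

fun flat :: "'a::field_char_0 \<Rightarrow> triple_point \<Rightarrow> ('a \<times> 'a \<times> 'a) set"
  where
    "flat a Y1 = plane_set a H1 \<inter> plane_set a H2 \<inter> plane_set a H4"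
  | "flat a Y2 = plane_set a H1 \<inter> plane_set a H3 \<inter> plane_set a H5"
  | "flat a Y3 = plane_set a H2 \<inter> plane_set a H3 \<inter> plane_set a H6"

definition planes_through :: "'a::field_char_0 \<Rightarrow> triple_point \<Rightarrow> plane set"
  where "planes_through a Y = {H. flat a Y \<subseteq> plane_set a H}"

lemma planes_through_simps:
  fixes a :: "'a::field_char_0"
  assumes "a \<noteq> 0"
  shows "planes_through a Y1 = {H1, H2, H4}"
    and "planes_through a Y2 = {H1, H3, H5}"
    and "planes_through a Y3 = {H2, H3, H6}"
proof -
  have p: "plane_set a H1 = {(u, v, w). u = 0}" "plane_set a H2 = {(u, v, w). v = 0}"
    "plane_set a H3 = {(u, v, w). w = 0}" "plane_set a H4 = {(u, v, w). u - a * v = 0}"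
    "plane_set a H5 = {(u, v, w). u + w = 0}" "plane_set a H6 = {(u, v, w). v + w = 0}"
    by (auto simp: plane_set_def)
  have f: "flat a Y1 = {(0, 0, w) |w. True}" "flat a Y2 = {(0, v, 0) |v. True}"
    "flat a Y3 = {(u, 0, 0) |u. True}"
    by (auto simp: p)
  have *: "planes_through a Y = T"
    if "P \<in> flat a Y" "\<And>H. H \<notin> T \<Longrightarrow> P \<notin> plane_set a H"
      "\<And>H. H \<in> T \<Longrightarrow> flat a Y \<subseteq> plane_set a H" for Y T P
    using that unfolding planes_through_def by blast
  show "planes_through a Y1 = {H1, H2, H4}"
  proof (rule *[of "(0, 0, 1)"])
    show "(0, 0, 1) \<notin> plane_set a H" if "H \<notin> {H1, H2, H4}" for H
      using that by (cases H) (auto simp: p)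
  qed (auto simp: f p)
  show "planes_through a Y2 = {H1, H3, H5}"
  proof (rule *[of "(0, 1, 0)"])
    show "(0, 1, 0) \<notin> plane_set a H" if "H \<notin> {H1, H3, H5}" for H
      using that assms by (cases H) (auto simp: p)
  qed (auto simp: f p)
  show "planes_through a Y3 = {H2, H3, H6}"
  proof (rule *[of "(1, 0, 0)"])
    show "(1, 0, 0) \<notin> plane_set a H" if "H \<notin> {H2, H3, H6}" for H
      using that by (cases H) (auto simp: p)
  qed (auto simp: f p)
qed


section \<open>Free submodules\<close>

definition smul :: "'a::field_char_0 S \<Rightarrow> ('b \<Rightarrow> 'a S) \<Rightarrow> 'b \<Rightarrow> 'a S"
  where "smul s f = (\<lambda>x. s * f x)"

lemma module_smul: "module smul"
  by unfold_locales (auto simp: smul_def algebra_simps)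

text \<open>Possession of a basis; any such \<open>M\<close> is automatically a submodule.\<close>

definition free_submodule :: "('r::comm_ring_1 \<Rightarrow> 'b::ab_group_add \<Rightarrow> 'b) \<Rightarrow> 'b set \<Rightarrow> bool"
  where "free_submodule scale M \<longleftrightarrow>
    (\<exists>B. \<not> module.dependent scale B \<and> module.span scale B = M)"


section \<open>Multiderivations\<close>

definition Der :: "('a::field_char_0 S \<Rightarrow> 'a S) set"
  where "Der = {\<theta>. (\<forall>p q. \<theta> (p + q) = \<theta> p + \<theta> q) \<and>
                    (\<forall>c p. \<theta> (cS c * p) = cS c * \<theta> p) \<and>
                    (\<forall>p q. \<theta> (p * q) = p * \<theta> q + q * \<theta> p)}"

definition J_plane :: "'a::field_char_0 \<Rightarrow> (plane \<Rightarrow> nat) \<Rightarrow> plane \<Rightarrow> 'a S set"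
  where "J_plane a m H = {lform a H ^ m H * s |s. True}"

definition D_X3 :: "'a::field_char_0 \<Rightarrow> (plane \<Rightarrow> nat) \<Rightarrow> ('a S \<Rightarrow> 'a S) set"
  where "D_X3 a m = {\<theta> \<in> Der. \<forall>H. \<theta> (lform a H) \<in> J_plane a m H}"

lemma subspace_D_X3: "module.subspace smul (D_X3 a m)"
proof -
  have J: "p \<in> J_plane a m H \<longleftrightarrow> lform a H ^ m H dvd p" for p H
    by (auto simp: J_plane_def dvd_def)
  show ?thesis
    unfolding module.subspace_def[OF module_smul] D_X3_def Der_def J
    by (auto simp: smul_def algebra_simps)
qed


section \<open>The complex\<close>

definition J_triple :: "'a::field_char_0 \<Rightarrow> (plane \<Rightarrow> nat) \<Rightarrow> triple_point \<Rightarrow> 'a S set"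
  where "J_triple a m Y =
    {(\<Sum>H\<in>planes_through a Y. f H) |f. \<forall>H\<in>planes_through a Y. f H \<in> J_plane a m H}"

definition cochain1 :: "'a::field_char_0 \<Rightarrow> (plane \<Rightarrow> nat) \<Rightarrow> (plane \<Rightarrow> 'a S) set"
  where "cochain1 a m = {f. \<forall>H. f H \<in> J_plane a m H}"

definition cochain2 :: "'a::field_char_0 \<Rightarrow> (plane \<Rightarrow> nat) \<Rightarrow> (triple_point \<Rightarrow> 'a S) set"
  where "cochain2 a m = {g. \<forall>Y. g Y \<in> J_triple a m Y}"

fun delta_matrix :: "'a::field_char_0 \<Rightarrow> triple_point \<Rightarrow> plane \<Rightarrow> 'a"
  where
    "delta_matrix a Y1 H =
       (case H of H1 \<Rightarrow> 1 | H2 \<Rightarrow> - a | H3 \<Rightarrow> 0 | H4 \<Rightarrow> - 1 | H5 \<Rightarrow> 0 | H6 \<Rightarrow> 0)"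
  | "delta_matrix a Y2 H =
       (case H of H1 \<Rightarrow> 1 | H2 \<Rightarrow> 0 | H3 \<Rightarrow> 1 | H4 \<Rightarrow> 0 | H5 \<Rightarrow> - 1 | H6 \<Rightarrow> 0)"
  | "delta_matrix a Y3 H =
       (case H of H1 \<Rightarrow> 0 | H2 \<Rightarrow> 1 | H3 \<Rightarrow> 1 | H4 \<Rightarrow> 0 | H5 \<Rightarrow> 0 | H6 \<Rightarrow> - 1)"

definition delta1 :: "'a::field_char_0 \<Rightarrow> (plane \<Rightarrow> 'a S) \<Rightarrow> (triple_point \<Rightarrow> 'a S)"
  where "delta1 a f = (\<lambda>Y. \<Sum>H\<in>UNIV. cS (delta_matrix a Y H) * f H)"

lemma delta1_cochain:
  fixes a :: "'a::field_char_0"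
  assumes "a \<noteq> 0" and f: "f \<in> cochain1 a m"
  shows "delta1 a f \<in> cochain2 a m"
proof -
  have "delta1 a f Y \<in> J_triple a m Y" for Y
  proof -
    have "delta1 a f Y = (\<Sum>H\<in>planes_through a Y. cS (delta_matrix a Y H) * f H)"
      unfolding delta1_def
      by (rule sum.mono_neutral_right)
        (cases Y; auto simp: planes_through_simps[OF assms(1)] cS_def split: plane.splits)+
    moreover have "cS (delta_matrix a Y H) * f H \<in> J_plane a m H" for H
    proof -
      obtain s where "f H = lform a H ^ m H * s"
        using f by (auto simp: cochain1_def J_plane_def)
      then have "cS (delta_matrix a Y H) * f H = lform a H ^ m H * (cS (delta_matrix a Y H) * s)"
        by (simp only: mult.left_commute)
      then show ?thesis unfolding J_plane_def by blast
    qed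
    ultimately show ?thesis unfolding J_triple_def by blast
  qed
  then show ?thesis by (simp add: cochain2_def)
qed

text \<open>The quotient \<open>N / I\<close> is the set of classes of the relation below; its zero element is the class of \<open>0\<close>.\<close>

definition mod_rel :: "'b::ab_group_add set \<Rightarrow> 'b set \<Rightarrow> ('b \<times> 'b) set"
  where "mod_rel N I = {(u, v). u \<in> N \<and> v \<in> N \<and> u - v \<in> I}"

definition cohomology2 :: "'a::field_char_0 \<Rightarrow> (plane \<Rightarrow> nat) \<Rightarrow> (triple_point \<Rightarrow> 'a S) set set"
  where "cohomology2 a m =
    cochain2 a m // mod_rel (cochain2 a m) (delta1 a ` cochain1 a m)"

definition cohomology2_zero :: "'a::field_char_0 \<Rightarrow> (plane \<Rightarrow> nat) \<Rightarrow> (triple_point \<Rightarrow> 'a S) set"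
  where "cohomology2_zero a m =
    mod_rel (cochain2 a m) (delta1 a ` cochain1 a m) `` {0}"

end

theory Submission
  imports Defs
begin

text \<open>
  A derivation \<open>\<theta>\<close> is determined by \<open>\<theta> x, \<theta> y, \<theta> z\<close>, and the rows of \<open>\<delta>\<^sup>1\<close> are the linear relations
  among the six forms; so \<open>\<theta> \<mapsto> (\<theta> \<alpha>\<^sub>i)\<^sub>i\<close> identifies \<open>D(X\<^sub>3, m)\<close> with the kernel of
  \<open>\<delta>\<^sup>1 : J\<^sub>1 \<rightarrow> J\<^sub>2\<close>, and the claim is that this kernel is free exactly if \<open>\<delta>\<^sup>1\<close> is onto.

  If the kernel is free, suppose that three elements \<open>u\<^sub>1, u\<^sub>2, u\<^sub>3\<close> that form a regular sequence
  multiply a cochain \<open>c \<in> J\<^sub>2\<close> into the image, say \<open>u\<^sub>i c = \<delta>\<^sup>1 s\<^sub>i\<close>. The elements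
  \<open>u\<^sub>i s\<^sub>j - u\<^sub>j s\<^sub>i\<close> lie in the kernel and satisfy the Koszul relation; Koszul exactness, applied to
  the coordinates with respect to a basis, yields kernel elements \<open>e\<^sub>i\<close> with
  \<open>u\<^sub>i s\<^sub>j - u\<^sub>j s\<^sub>i = u\<^sub>i e\<^sub>j - u\<^sub>j e\<^sub>i\<close>. Hence \<open>s\<^sub>1 - e\<^sub>1\<close> is divisible by \<open>u\<^sub>1\<close>, and
  \<open>\<delta>\<^sup>1\<close> maps the quotient to \<open>c\<close> (\<open>regular_annihilator_imp_coboundary\<close>). This unrolls
  the argument that a nonzero module of finite length over \<open>S\<close> has projective dimension three.
  It remains to annihilate generators of the cokernel by regular sequences. The cokernel is generated
  by \<open>x\<^bsup>m\<^sub>1\<^esup>\<close> and \<open>y\<^bsup>m\<^sub>2\<^esup>\<close> at \<open>Y\<^sub>1\<close> and \<open>z\<^bsup>m\<^sub>3\<^esup>\<close> at \<open>Y\<^sub>2\<close>, and for each of them explicit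
  products of powers of the six forms work (\<open>generators_are_coboundaries\<close>); that such a product
  is regular modulo the other two comes down to \<open>\<alpha> \<noteq> 0, 1\<close>.

  Conversely, at each triple point the triples of compatible values are the syzygies of three
  powers of linear forms in two variables. They form a free module of rank two with a homogeneous basis
  (\<open>pencil_basis_exists\<close>, by induction on the exponent of the third form). An element of the kernel of
  \<open>\<delta>\<^sup>1\<close> is a choice of one syzygy at each triple point such that the three choices agree on the
  planes \<open>H\<^sub>1, H\<^sub>2, H\<^sub>3\<close>. In coordinates this is the kernel of a homogeneous \<open>3 \<times> 6\<close> matrix
  whose cokernel is that of \<open>\<delta>\<^sup>1\<close>. If the cokernel vanishes, every row in turn has an entry with
  nonzero constant term, which by homogeneity is a constant; Gaussian elimination with these pivots
  solves for three of the six coordinates (\<open>homogeneous_kernel\<close>), and the other three are free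
  parameters.
\<close>


section \<open>Substitutions and linear forms\<close>

text \<open>
  All substitutions and evaluations below are instances of one predicate, so that an identity between
  two of them needs to be checked on the constants and on the three variables only
  (\<open>ring_map_eqI\<close>).
\<close>

definition ring_map :: "('r::comm_ring_1 \<Rightarrow> 's::comm_ring_1) \<Rightarrow> bool"
  where "ring_map h \<longleftrightarrow> h 1 = 1 \<and> (\<forall>a b. h (a + b) = h a + h b) \<and> (\<forall>a b. h (a * b) = h a * h b)"

lemma ring_mapD:
  assumes "ring_map h"
  shows "h 1 = 1" "h (a + b) = h a + h b" "h (a * b) = h a * h b"
    "h 0 = 0" "h (- a) = - h a" "h (a - b) = h a - h b" "h (a ^ n) = h a ^ n"
proof -
  show *: "h 1 = 1" "h (a + b) = h a + h b" "h (a * b) = h a * h b" for a b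
    using assms by (auto simp: ring_map_def)
  show 0: "h 0 = 0" using *(2)[of 0 0] by simp
  have m: "h (- a) = - h a" for a
    using *(2)[of a "- a"] 0 by (simp add: add_eq_0_iff2)
  then show "h (- a) = - h a" .
  show "h (a - b) = h a - h b" using *(2)[of a "- b"] m by simp
  show "h (a ^ n) = h a ^ n" by (induction n) (simp_all add: *)
qed

lemma ring_map_numeral:
  assumes "ring_map h"
  shows "h (numeral n) = numeral n"
  by (induction n) (simp_all only: numeral.simps ring_mapD[OF assms])

lemma ring_map_sum:
  assumes "ring_map h"
  shows "h (\<Sum>i\<in>I. f i) = (\<Sum>i\<in>I. h (f i))"
  by (induction I rule: infinite_finite_induct) (simp_all add: ring_mapD[OF assms])

lemma ring_map_dvd: "ring_map h \<Longrightarrow> p dvd q \<Longrightarrow> h p dvd h q"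
  by (auto simp: ring_mapD elim!: dvdE)

lemma ring_map_comp: "ring_map g \<Longrightarrow> ring_map h \<Longrightarrow> ring_map (\<lambda>p. g (h p))"
  by (simp add: ring_map_def)

lemma map_poly_add_hom:
  assumes "h 0 = 0" "\<And>a b. h (a + b) = h a + h b"
  shows "map_poly h (p + q) = map_poly h p + map_poly h q"
  by (rule poly_eqI) (simp add: coeff_map_poly assms)

lemma ring_map_poly_map:
  assumes "ring_map h"
  shows "ring_map (\<lambda>p. poly (map_poly h p) X)"
proof -
  note h = ring_mapD[OF assms]
  have add: "poly (map_poly h (p + q)) X = poly (map_poly h p) X + poly (map_poly h q) X" for p q
    by (subst map_poly_add_hom[of h]) (simp_all add: h)
  have sm: "poly (map_poly h (smult c q)) X = h c * poly (map_poly h q) X" for c q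
    by (induction q) (simp_all add: map_poly_pCons h algebra_simps)
  have "poly (map_poly h (p * q)) X = poly (map_poly h p) X * poly (map_poly h q) X" for p q
    by (induction p) (simp_all add: map_poly_pCons h add sm algebra_simps)
  then show ?thesis
    by (simp add: ring_map_def add map_poly_1 h)
qed

lemma ring_map_cS: "ring_map (cS :: 'a::field_char_0 \<Rightarrow> _)"
  by (simp add: ring_map_def cS_def one_pCons)

lemma cS_simps [simp]:
  "cS 0 = 0" "cS 1 = 1" "cS (numeral n) = numeral n" "cS a = cS b \<longleftrightarrow> a = b" "cS a = 0 \<longleftrightarrow> a = 0"
  by (simp_all add: ring_mapD ring_map_numeral ring_map_cS) (simp_all add: cS_def)

lemma cS_eq_1_iff [simp]: "cS a = 1 \<longleftrightarrow> a = 1"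
  by (simp add: cS_def one_pCons)

lemma S_induct [case_names const x y z add mult]:
  fixes f :: "'a::field_char_0 S"
  assumes c: "\<And>c. P (cS c)" and x: "P xS" and y: "P yS" and z: "P zS"
    and add: "\<And>p q. P p \<Longrightarrow> P q \<Longrightarrow> P (p + q)" and mult: "\<And>p q. P p \<Longrightarrow> P q \<Longrightarrow> P (p * q)"
  shows "P f"
proof -
  have 1: "P [:[:p:]:]" for p :: "'a poly"
  proof (induction p)
    case 0
    then show ?case using c[of 0] by (simp add: cS_def)
  next
    case (pCons a p)
    have "[:[:pCons a p:]:] = cS a + xS * [:[:p:]:]"
      by (simp add: cS_def xS_def)
    then show ?case using c x pCons add mult by metis
  qed
  have 2: "P [:p:]" for p :: "'a poly poly"
  proof (induction p)
    case 0
    then show ?case using c[of 0] by (simp add: cS_def)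
  next
    case (pCons a p)
    have "[:pCons a p:] = [:[:a:]:] + yS * [:p:]"
      by (simp add: yS_def)
    then show ?case using 1 y pCons add mult by metis
  qed
  show ?thesis
  proof (induction f)
    case 0
    then show ?case using c[of 0] by (simp add: cS_def)
  next
    case (pCons a p)
    have "pCons a p = [:a:] + zS * p"
      by (simp add: zS_def)
    then show ?case using 2 z pCons add mult by metis
  qed
qed

lemma ring_map_eqI:
  fixes g h :: "'a::field_char_0 S \<Rightarrow> 'r::comm_ring_1"
  assumes g: "ring_map g" and h: "ring_map h" and "\<And>c. g (cS c) = h (cS c)"
    and "g xS = h xS" "g yS = h yS" "g zS = h zS"
  shows "g f = h f"
  by (induction f rule: S_induct) (simp_all add: assms ring_mapD[OF g] ring_mapD[OF h])

definition subst :: "('a::field_char_0 \<Rightarrow> 'r::comm_ring_1) \<Rightarrow> 'r \<Rightarrow> 'r \<Rightarrow> 'r \<Rightarrow> 'a S \<Rightarrow> 'r"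
  where "subst k X Y Z f =
    poly (map_poly (\<lambda>p. poly (map_poly (\<lambda>q. poly (map_poly k q) X) p) Y) f) Z"

lemma ring_map_subst: "ring_map k \<Longrightarrow> ring_map (subst k X Y Z)"
  unfolding subst_def by (intro ring_map_poly_map)

lemma subst_gens:
  assumes "ring_map k"
  shows "subst k X Y Z (cS c) = k c" "subst k X Y Z xS = X"
    "subst k X Y Z yS = Y" "subst k X Y Z zS = Z"
proof -
  note 1 = ring_map_poly_map[OF assms, of X] note 2 = ring_map_poly_map[OF 1, of Y]
  show "subst k X Y Z (cS c) = k c" "subst k X Y Z xS = X"
    "subst k X Y Z yS = Y" "subst k X Y Z zS = Z"
    by (simp_all add: subst_def cS_def xS_def yS_def zS_def map_poly_pCons
       ring_mapD[OF 1] ring_mapD[OF 2] ring_mapD[OF assms])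
qed

abbreviation endo :: "'a::field_char_0 S \<Rightarrow> 'a S \<Rightarrow> 'a S \<Rightarrow> 'a S \<Rightarrow> 'a S"
  where "endo \<equiv> subst cS"

lemmas ring_map_endo = ring_map_subst[OF ring_map_cS]
lemmas endo_simps [simp] = subst_gens[OF ring_map_cS] ring_mapD[OF ring_map_endo]
  ring_map_numeral[OF ring_map_endo]

lemma endo_id [simp]: "endo xS yS zS f = f"
  by (rule ring_map_eqI[OF ring_map_endo]) (simp_all add: ring_map_def)

lemma endo_congruent_ideal:
  assumes add: "\<And>p q. p \<in> I \<Longrightarrow> q \<in> I \<Longrightarrow> p + q \<in> I" and mult: "\<And>p q. p \<in> I \<Longrightarrow> q * p \<in> I"
    and gens: "X - X' \<in> I" "Y - Y' \<in> I" "Z - Z' \<in> I"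
  shows "endo X Y Z f - endo X' Y' Z' f \<in> I"
proof (induction f rule: S_induct)
  case (const c)
  show ?case using mult[OF gens(1), of 0] by simp
next
  case (add p q)
  then have "(endo X Y Z p - endo X' Y' Z' p) + (endo X Y Z q - endo X' Y' Z' q) \<in> I"
    by (rule assms(1))
  then show ?case by (simp add: algebra_simps)
next
  case (mult p q)
  then have "endo X Y Z p * (endo X Y Z q - endo X' Y' Z' q)
      + endo X' Y' Z' q * (endo X Y Z p - endo X' Y' Z' p) \<in> I"
    by (intro assms(1) assms(2))
  then show ?case by (simp add: algebra_simps)
qed (simp_all add: gens)

lemma endo_congruent:
  assumes "L dvd X - X'" "L dvd Y - Y'" "L dvd Z - Z'"
  shows "L dvd endo X Y Z f - endo X' Y' Z' f"
  using endo_congruent_ideal[of "{p. L dvd p}" X X' Y Y' Z Z' f] assms by simp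

text \<open>
  A substitution that moves each variable by a multiple of \<open>L\<close> changes every polynomial by a multiple
  of \<open>L\<close>; if it also kills \<open>L\<close>, then its kernel is exactly the ideal generated by \<open>L\<close>.
\<close>

lemma linear_dvd_iff:
  assumes "L dvd xS - A" "L dvd yS - B" "L dvd zS - C" "endo A B C L = 0"
  shows "L dvd f \<longleftrightarrow> endo A B C f = 0"
proof
  assume "L dvd f"
  from ring_map_dvd[OF ring_map_endo this, of A B C] show "endo A B C f = 0"
    using assms(4) by simp
next
  assume "endo A B C f = 0"
  then show "L dvd f"
    using endo_congruent[OF assms(1-3), of f] by simp
qed

lemma gens_nonzero [simp]: "xS \<noteq> 0" "yS \<noteq> 0" "zS \<noteq> 0"
  by (simp_all add: xS_def yS_def zS_def)

lemma lform_neq_0: "lform a H \<noteq> 0"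
  by (cases H) (simp_all add: cS_def xS_def yS_def zS_def)

text \<open>
  Restriction of a polynomial to the plane \<open>H\<close>, by eliminating one variable. Its kernel is the
  principal ideal of the linear form, which is therefore prime.
\<close>

fun restrict :: "'a::field_char_0 \<Rightarrow> plane \<Rightarrow> 'a S \<Rightarrow> 'a S"
  where
    "restrict a H1 = endo 0 yS zS"
  | "restrict a H2 = endo xS 0 zS"
  | "restrict a H3 = endo xS yS 0"
  | "restrict a H4 = endo (cS a * yS) yS zS"
  | "restrict a H5 = endo xS yS (- xS)"
  | "restrict a H6 = endo xS yS (- yS)"

lemma lform_dvd_iff: "lform a H dvd f \<longleftrightarrow> restrict a H f = 0"
  by (cases H; simp only: restrict.simps lform.simps; rule linear_dvd_iff) (simp_all add: add.commute)

lemma ring_map_restrict: "ring_map (restrict a H)"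
  by (cases H) (simp_all add: ring_map_endo)

lemma prime_elem_lform: "prime_elem (lform a H)"
  unfolding prime_elem_def lform_dvd_iff
  by (simp add: lform_neq_0 ring_mapD[OF ring_map_restrict])

section \<open>Regular sequences and the Koszul relation\<close>

lemma prime_elem_power_cancel:
  fixes u :: "'r::idom"
  assumes u: "prime_elem u" "\<not> u dvd q" and "u ^ n dvd q * f"
  shows "u ^ n dvd f"
  using assms(3)
proof (induction n arbitrary: f)
  case (Suc n)
  then have "u dvd q * f" by (metis dvd_triv_left dvd_trans power_Suc)
  then have "u dvd f" using u prime_elem_dvd_mult_iff by blast
  then obtain f' where f: "f = u * f'" by (elim dvdE)
  have "u * u ^ n dvd u * (q * f')"
    using Suc.prems unfolding f by (metis mult.left_commute power_Suc)
  then have "u ^ n dvd q * f'"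
    using u(1) by (simp only: dvd_mult_cancel_left) (simp add: prime_elem_def)
  from Suc.IH[OF this] show ?case unfolding f by (simp add: mult_dvd_mono)
qed simp

text \<open>
  Multiplication by \<open>p\<close> is injective on the quotient by the ideal \<open>(u, v)\<close>.
\<close>

definition regular_modulo :: "'r::idom \<Rightarrow> 'r \<Rightarrow> 'r \<Rightarrow> bool"
  where "regular_modulo p u v \<longleftrightarrow> (\<forall>g r s. p * g = u * r + v * s \<longrightarrow> (\<exists>r s. g = u * r + v * s))"

lemma regular_modulo_commute: "regular_modulo p u v \<longleftrightarrow> regular_modulo p v u"
proof -
  have "regular_modulo p v u" if uv: "regular_modulo p u v" for u v
    unfolding regular_modulo_def
  proof (intro allI impI)
    fix g r s assume "p * g = v * r + u * s"
    then have "p * g = u * s + v * r" by simp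
    then obtain r s where "g = u * r + v * s" using uv unfolding regular_modulo_def by blast
    then have "g = v * s + u * r" by simp
    then show "\<exists>r s. g = v * r + u * s" by blast
  qed
  then show ?thesis by blast
qed

text \<open>
  The quotient by \<open>(u\<^sub>1 u\<^sub>2, v)\<close> is an extension of the quotients by \<open>(u\<^sub>2, v)\<close> and by
  \<open>(u\<^sub>1, v)\<close>: injectivity passes to the extension. Iterated, this reduces powers of two linear forms to
  the linear forms themselves.
\<close>

lemma regular_modulo_mult:
  assumes p1: "regular_modulo p u1 v" and p2: "regular_modulo p u2 v"
    and cancel: "\<And>q. v dvd u2 * q \<Longrightarrow> v dvd q" and "u2 \<noteq> 0"
  shows "regular_modulo p (u1 * u2) v"
  unfolding regular_modulo_def
proof (intro allI impI)
  fix g r s assume 1: "p * g = u1 * u2 * r + v * s"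
  then have "p * g = u2 * (u1 * r) + v * s" by simp
  then obtain g' t where g: "g = u2 * g' + v * t" using p2 unfolding regular_modulo_def by blast
  have "u2 * (p * g' - u1 * r) = v * (s - p * t)"
    using 1 g by algebra
  then have "v dvd p * g' - u1 * r" by (metis cancel dvd_triv_left)
  then obtain q where "p * g' - u1 * r = v * q" by (elim dvdE)
  then have "p * g' = u1 * r + v * q" by algebra
  then obtain r' s' where g': "g' = u1 * r' + v * s'" using p1 unfolding regular_modulo_def by blast
  then have "g = u1 * u2 * r' + v * (u2 * s' + t)" using g g' by algebra
  then show "\<exists>r s. g = u1 * u2 * r + v * s" by blast
qed

lemma regular_modulo_1: "regular_modulo p 1 (v :: 'r::idom)"
  unfolding regular_modulo_def
proof (intro allI impI)
  fix g :: 'r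
  have "g = 1 * g + v * 0" by simp
  then show "\<exists>r s. g = 1 * r + v * s" by blast
qed

lemma regular_modulo_power_left:
  assumes "regular_modulo p u v" "\<And>q. v dvd u * q \<Longrightarrow> v dvd q" "u \<noteq> 0"
  shows "regular_modulo p (u ^ k) v"
proof (induction k)
  case 0
  show ?case by (simp add: regular_modulo_1)
next
  case (Suc k)
  show ?case
    unfolding power_Suc2 by (rule regular_modulo_mult[OF Suc assms])
qed

lemma regular_modulo_powers:
  assumes "prime_elem u" "prime_elem v" "\<not> u dvd v" "\<not> v dvd u" "regular_modulo p u v"
  shows "regular_modulo p (u ^ k) (v ^ l)"
proof -
  have "regular_modulo p (u ^ k) v"
  proof (rule regular_modulo_power_left[OF assms(5)])
    show "v dvd q" if "v dvd u * q" for q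
      using that assms(2,4) prime_elem_dvd_mult_iff by blast
    show "u \<noteq> 0" using assms(1) by (simp add: prime_elem_def)
  qed
  then have "regular_modulo p v (u ^ k)" by (simp add: regular_modulo_commute)
  then have "regular_modulo p (v ^ l) (u ^ k)"
  proof (rule regular_modulo_power_left)
    show "u ^ k dvd q" if "u ^ k dvd v * q" for q
      using prime_elem_power_cancel[OF assms(1,3) that] .
    show "v \<noteq> 0" using assms(2) by (simp add: prime_elem_def)
  qed
  then show ?thesis by (simp add: regular_modulo_commute)
qed

text \<open>
  The base case: the ideal \<open>(u, v)\<close> of a line is the kernel of the substitution that restricts to this
  line, hence prime, and \<open>p\<close> does not vanish on the line.
\<close>

lemma regular_modulo_linear:
  assumes "\<exists>r s. xS - A = u * r + v * s" "\<exists>r s. yS - B = u * r + v * s" "\<exists>r s. zS - C = u * r + v * s"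
    and "endo A B C u = 0" "endo A B C v = 0" "endo A B C p \<noteq> 0"
  shows "regular_modulo p u v"
  unfolding regular_modulo_def
proof (intro allI impI)
  fix g r s assume "p * g = u * r + v * s"
  then have "endo A B C (p * g) = endo A B C (u * r + v * s)" by simp
  then have "endo A B C g = 0" using assms(4-6) by simp
  moreover have "endo xS yS zS g - endo A B C g \<in> {p. \<exists>r s. p = u * r + v * s}"
  proof (rule endo_congruent_ideal)
    fix p q assume "p \<in> {p. \<exists>r s. p = u * r + v * s}" "q \<in> {p. \<exists>r s. p = u * r + v * s}"
    then obtain r s r' s' where "p = u * r + v * s" "q = u * r' + v * s'" by blast
    then have "p + q = u * (r + r') + v * (s + s')" by (simp add: algebra_simps)
    then show "p + q \<in> {p. \<exists>r s. p = u * r + v * s}" by blast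
  next
    fix p q assume "p \<in> {p. \<exists>r s. p = u * r + v * s}"
    then obtain r s where "p = u * r + v * s" by blast
    then have "q * p = u * (q * r) + v * (q * s)" by (simp add: algebra_simps)
    then show "q * p \<in> {p. \<exists>r s. p = u * r + v * s}" by blast
  qed (rule CollectI, fact assms)+
  ultimately show "\<exists>r s. g = u * r + v * s" by simp
qed

definition regular_triple :: "'r::idom \<Rightarrow> 'r \<Rightarrow> 'r \<Rightarrow> bool"
  where "regular_triple u1 u2 u3 \<longleftrightarrow>
    u1 \<noteq> 0 \<and> (\<forall>f. u1 dvd u2 * f \<longrightarrow> u1 dvd f) \<and> regular_modulo u3 u1 u2"

text \<open>
  Exactness of the Koszul complex at its second syzygies: divide \<open>d\<^sub>1\<^sub>2\<close> using that \<open>u\<^sub>3\<close> is regular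
  modulo \<open>(u\<^sub>1, u\<^sub>2)\<close>, then the rest using that \<open>u\<^sub>2\<close> is regular modulo \<open>u\<^sub>1\<close>.
\<close>

lemma koszul_exact:
  assumes "regular_triple u1 u2 u3" and rel: "u1 * d23 - u2 * d13 + u3 * d12 = 0"
  shows "\<exists>e1 e2 e3. d12 = u1 * e2 - u2 * e1 \<and> d13 = u1 * e3 - u3 * e1 \<and> d23 = u2 * e3 - u3 * e2"
proof -
  have u1: "u1 \<noteq> 0" and u2: "\<And>f. u1 dvd u2 * f \<Longrightarrow> u1 dvd f" and u3: "regular_modulo u3 u1 u2"
    using assms(1) unfolding regular_triple_def by (simp, metis, simp)
  have rel': "u1 * d23 = u2 * d13 - u3 * d12"
    using rel by algebra
  then have "u3 * d12 = u1 * (- d23) + u2 * d13" by simp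
  then obtain e2 s where 0: "d12 = u1 * e2 + u2 * s"
    by (metis u3 regular_modulo_def)
  define e1 where "e1 = - s"
  have 1: "d12 = u1 * e2 - u2 * e1" unfolding 0 e1_def by simp
  have 2: "u1 * (d23 + u3 * e2) = u2 * (d13 + u3 * e1)"
    using rel' unfolding 1 by algebra
  then have "u1 dvd d13 + u3 * e1" by (metis u2 dvd_triv_left)
  then obtain e3 where 3: "d13 + u3 * e1 = u1 * e3" by (elim dvdE)
  have "u1 * (d23 + u3 * e2) = u1 * (u2 * e3)"
    unfolding 2 3 by (rule mult.left_commute)
  then have 4: "d23 + u3 * e2 = u2 * e3" using u1 by simp
  have "d13 = u1 * e3 - u3 * e1" "d23 = u2 * e3 - u3 * e2"
    by (simp_all flip: 3 4)
  with 1 show ?thesis by blast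
qed

text \<open>
  The coordinates with respect to a basis satisfy the relation separately, and only finitely many
  of them are nonzero.
\<close>

lemma koszul_exact_free:
  fixes M :: "('b \<Rightarrow> 'a::field_char_0 S) set"
  assumes free: "free_submodule smul M" and reg: "regular_triple u1 u2 u3"
    and M: "d12 \<in> M" "d13 \<in> M" "d23 \<in> M"
    and rel: "smul u1 d23 - smul u2 d13 + smul u3 d12 = 0"
  shows "\<exists>e1\<in>M. \<exists>e2\<in>M. \<exists>e3\<in>M. d12 = smul u1 e2 - smul u2 e1 \<and> d13 = smul u1 e3 - smul u3 e1
     \<and> d23 = smul u2 e3 - smul u3 e2"
proof -
  interpret module "smul :: 'a S \<Rightarrow> ('b \<Rightarrow> 'a S) \<Rightarrow> _" by (rule module_smul)
  obtain B where B: "independent B" "span B = M"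
    using free unfolding free_submodule_def by blast
  define r where "r d = representation B d" for d
  have "u1 * r d23 b - u2 * r d13 b + u3 * r d12 b = 0" for b
  proof -
    have "r (smul u1 d23 - smul u2 d13 + smul u3 d12) b = u1 * r d23 b - u2 * r d13 b + u3 * r d12 b"
    proof -
      have M': "d12 \<in> span B" "d13 \<in> span B" "d23 \<in> span B" using B(2) M by simp_all
      then show ?thesis unfolding r_def
        using representation_add[OF B(1), of "smul u3 d12" "smul u1 d23 - smul u2 d13"]
          representation_diff[OF B(1), of "smul u2 d13" "smul u1 d23"]
        by (simp add: representation_scale[OF B(1)] span_scale span_diff)
    qed
    then show ?thesis by (simp add: rel r_def representation_zero)
  qed
  from koszul_exact[OF reg this]
  obtain e1 e2 e3 where e: "\<And>b. r d12 b = u1 * e2 b - u2 * e1 b" "\<And>b. r d13 b = u1 * e3 b - u3 * e1 b"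
     "\<And>b. r d23 b = u2 * e3 b - u3 * e2 b"
    by metis
  define F where "F = {b. r d12 b \<noteq> 0} \<union> {b. r d13 b \<noteq> 0} \<union> {b. r d23 b \<noteq> 0}"
  have F: "finite F" "F \<subseteq> B"
    by (auto simp: F_def r_def finite_representation dest: representation_ne_zero)
  have expand: "d = (\<Sum>b\<in>F. smul (r d b) b)" if "d \<in> {d12, d13, d23}" for d
  proof -
    have "d = (\<Sum>b | r d b \<noteq> 0. smul (r d b) b)"
      using B M that unfolding r_def by (subst sum_nonzero_representation_eq) auto
    also have "\<dots> = (\<Sum>b\<in>F. smul (r d b) b)"
      using that F(1) by (intro sum.mono_neutral_left) (auto simp: F_def)
    finally show ?thesis .
  qed
  define E where "E e = (\<Sum>b\<in>F. smul (e b) b)" for e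
  have E: "E e \<in> M" for e
    unfolding E_def B(2)[symmetric] using F(2) by (intro span_sum span_scale span_base) auto
  have comb: "(\<Sum>b\<in>F. smul (p * e b - q * e' b) b) = smul p (E e) - smul q (E e')" for p q e e'
    by (simp add: E_def scale_left_diff_distrib sum_subtractf scale_sum_right)
  have "d12 = smul u1 (E e2) - smul u2 (E e1)" "d13 = smul u1 (E e3) - smul u3 (E e1)"
    "d23 = smul u2 (E e3) - smul u3 (E e2)"
    by (subst expand, simp, simp only: e comb)+
  then show ?thesis using E by blast
qed

section \<open>Homogeneous polynomials as eigenvectors of a dilation\<close>

abbreviation dilate :: "'a::field_char_0 S \<Rightarrow> 'a S"
  where "dilate \<equiv> endo (2 * xS) (2 * yS) (2 * zS)"

text \<open>
  A homogeneous polynomial of degree \<open>d\<close> is an eigenvector of \<open>f(x, y, z) \<mapsto> f(2x, 2y, 2z)\<close> for the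
  eigenvalue \<open>2\<^sup>d\<close>, and in characteristic zero the eigenvalues determine the degrees. Recording the
  eigenvalue \<open>w\<close> instead of the degree makes negative degrees available: dividing forms divides the
  eigenvalues, without any comparison of degrees.
\<close>

definition homog :: "'a::field_char_0 \<Rightarrow> 'a S \<Rightarrow> bool"
  where "homog w f \<longleftrightarrow> dilate f = cS w * f"

lemma cS_mult: "cS (a * b) = cS a * cS b" and cS_add: "cS (a + b) = cS a + cS b"
  and cS_diff: "cS (a - b) = cS a - cS b" and cS_minus: "cS (- a) = - cS a"
  and cS_power: "cS (a ^ n) = cS a ^ n"
  by (rule ring_mapD[OF ring_map_cS])+

lemma homog_mult: "homog w f \<Longrightarrow> homog v g \<Longrightarrow> homog (w * v) (f * g)"
  by (simp add: homog_def cS_mult)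

lemma homog_add: "homog w f \<Longrightarrow> homog w g \<Longrightarrow> homog w (f + g)"
  by (simp add: homog_def algebra_simps)

lemma homog_diff: "homog w f \<Longrightarrow> homog w g \<Longrightarrow> homog w (f - g)"
  by (simp add: homog_def algebra_simps)

lemma homog_minus: "homog w f \<Longrightarrow> homog w (- f)"
  by (simp add: homog_def)

lemma homog_0: "homog w 0"
  by (simp add: homog_def)

lemma homog_const: "homog 1 (cS c)"
  by (simp add: homog_def)

lemma homog_scale: "homog w f \<Longrightarrow> homog w (cS c * f)"
  using homog_mult[OF homog_const] by simp

lemma homog_power: "homog w f \<Longrightarrow> homog (w ^ n) (f ^ n)"
  by (simp add: homog_def cS_power power_mult_distrib)

lemma homog_sum: "(\<And>i. i \<in> I \<Longrightarrow> homog w (f i)) \<Longrightarrow> homog w (\<Sum>i\<in>I. f i)"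
  by (induction I rule: infinite_finite_induct) (simp_all add: homog_0 homog_add)

lemma homog_gens: "homog 2 xS" "homog 2 yS" "homog 2 zS"
  by (simp_all add: homog_def)

lemma homog_lform: "homog 2 (lform a H)"
  by (cases H) (simp_all add: homog_gens homog_add homog_diff homog_scale)

lemma homog_cancel:
  assumes "homog v u" "homog w (u * f)" "u \<noteq> 0" "v \<noteq> 0"
  shows "homog (w / v) f"
proof -
  have "(cS v * u) * dilate f = cS w * (u * f)"
    using assms by (simp add: homog_def)
  also have "\<dots> = (cS v * u) * (cS (w / v) * f)"
    using assms(4) by (simp add: cS_mult[symmetric] mult_ac)
  finally show ?thesis
    using assms(3,4) by (simp add: homog_def)
qed

abbreviation const_term :: "'a::field_char_0 S \<Rightarrow> 'a"
  where "const_term f \<equiv> evalS f (0, 0, 0)"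

lemma ring_map_evalS: "ring_map (\<lambda>f. evalS f P)"
proof -
  have "evalS 1 P = 1" using evalS_simps(1)[of 1] by (cases P) simp
  then show ?thesis by (simp add: ring_map_def)
qed

lemmas ring_map_const_term = ring_map_evalS[of "(0, 0, 0)"]
lemmas evalS_ring [simp] = ring_mapD[OF ring_map_evalS]

lemma nonzero_by_evaluation: "evalS f P \<noteq> 0 \<Longrightarrow> f \<noteq> 0"
  by auto

text \<open>
  Comparing constant terms gives \<open>w = 1\<close>, so \<open>f\<close> is invariant. Then \<open>t \<mapsto> f(tx, ty, tz)\<close> is a
  polynomial in \<open>t\<close> that takes the value \<open>f\<close> at all the powers of two, hence is constant, and its value
  at \<open>t = 0\<close> is the constant term.
\<close>

lemma homog_unit:
  assumes f: "homog w f" and nz: "const_term f \<noteq> 0"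
  shows "w = 1" and "f = cS (const_term f)"
proof -
  note e = ring_mapD[OF ring_map_const_term] ring_map_numeral[OF ring_map_const_term]
  have "const_term (dilate f) = const_term f"
    by (rule ring_map_eqI[OF ring_map_comp[OF ring_map_const_term ring_map_endo] ring_map_const_term])
      (simp_all add: e)
  then show w: "w = 1" using f nz by (simp add: homog_def e)
  \<comment> \<open>\<open>H f\<close> is \<open>f(tx, ty, tz)\<close> as a polynomial in \<open>t\<close>\<close>
  define H where "H = subst (\<lambda>c. [:cS c:]) [:0, xS:] [:0, yS:] [:0, zS :: 'a S:]"
  have k: "ring_map (\<lambda>c :: 'a. [:cS c:])"
    by (simp add: ring_map_def cS_mult cS_add one_pCons)
  have H: "ring_map H" unfolding H_def by (rule ring_map_subst[OF k])
  have rp: "ring_map (\<lambda>g. poly (H g) t)" for t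
    by (simp add: ring_map_def ring_mapD[OF H])
  note Hs = subst_gens[OF k, of "[:0, xS:]" "[:0, yS:]" "[:0, zS:]", folded H_def]
  have scale: "poly (H g) (2 * t) = poly (H (dilate g)) t" for g t
    by (rule ring_map_eqI[OF rp ring_map_comp[OF rp ring_map_endo]])
       (simp_all add: ring_mapD[OF H] ring_map_numeral[OF H] Hs)
  have one: "poly (H g) 1 = g" for g
    by (rule ring_map_eqI[OF rp]) (simp_all add: Hs ring_map_def)
  have zero: "poly (H g) 0 = cS (const_term g)" for g
    by (rule ring_map_eqI[OF rp ring_map_comp[OF ring_map_cS ring_map_const_term]]) (simp_all add: Hs)
  have fix_f: "dilate f = f" using f w by (simp add: homog_def)
  have pow: "poly (H f) (2 ^ n) = f" for n
  proof (induction n)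
    case (Suc n)
    then show ?case using scale[of f "2 ^ n"] by (simp add: fix_f)
  qed (simp add: one)
  have "inj (\<lambda>n. 2 ^ n :: 'a S)"
  proof (rule injI)
    fix m n assume "(2 :: 'a S) ^ m = 2 ^ n"
    then have "(of_nat (2 ^ m) :: 'a S) = of_nat (2 ^ n)" by simp
    then have "(2 :: nat) ^ m = 2 ^ n" by (simp only: of_nat_eq_iff)
    then show "m = n" by simp
  qed
  then have "infinite (range (\<lambda>n. 2 ^ n :: 'a S))"
    by (simp add: finite_image_iff)
  moreover have "range (\<lambda>n. 2 ^ n) \<subseteq> {t. poly (H f - [:f:]) t = 0}"
    by (auto simp: pow)
  ultimately have "infinite {t. poly (H f - [:f:]) t = 0}"
    using finite_subset by blast
  then have "H f - [:f:] = 0" using poly_roots_finite by blast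
  then have "poly (H f) 0 = f" by simp
  then show "f = cS (const_term f)" using zero by simp
qed

text \<open>
  Along a line through the origin a polynomial becomes a polynomial in one parameter, and the
  eigenvectors of \<open>t \<mapsto> 2t\<close> among these are the monomials.
\<close>

lemma homog_on_line:
  assumes "homog w f"
  shows "\<exists>c k. endo (cS p1 * l) (cS p2 * l) (cS p3 * l) f = cS c * l ^ k \<and> (c \<noteq> 0 \<longrightarrow> w = 2 ^ k)"
proof -
  \<comment> \<open>the one-variable polynomial \<open>f(p\<^sub>1 t, p\<^sub>2 t, p\<^sub>3 t)\<close>\<close>
  define E where "E = subst (\<lambda>c. [:c:]) [:0, p1:] [:0, p2:] [:0, p3:]"
  have k: "ring_map (\<lambda>c :: 'a. [:c:])"
    by (simp add: ring_map_def one_pCons)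
  have E: "ring_map E" unfolding E_def by (rule ring_map_subst[OF k])
  note Es = subst_gens[OF k, of "[:0, p1:]" "[:0, p2:]" "[:0, p3:]", folded E_def]
  have lift: "ring_map (\<lambda>g. poly (map_poly cS (E g)) l)"
    by (rule ring_map_comp[OF ring_map_poly_map[OF ring_map_cS] E])
  have 1: "endo (cS p1 * l) (cS p2 * l) (cS p3 * l) g = poly (map_poly cS (E g)) l" for g
    by (rule ring_map_eqI[OF ring_map_endo lift]) (simp_all add: Es map_poly_pCons mult.commute)
  have "ring_map (\<lambda>g. pcompose (E g) [:0, 2:])"
    by (simp add: ring_map_def ring_mapD[OF E] pcompose_add pcompose_mult pcompose_1)
  then have 2: "E (dilate g) = pcompose (E g) [:0, 2:]" for g
    by (rule ring_map_eqI[OF ring_map_comp[OF E ring_map_endo]],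
        simp_all add: ring_mapD[OF E] ring_map_numeral[OF E] Es pcompose_pCons,
        simp_all add: numeral_poly mult.commute)
  have "pcompose (E f) [:0, 2:] = smult w (E f)"
    using assms by (simp add: homog_def ring_mapD[OF E] Es flip: 2)
  then have co: "2 ^ n * coeff (E f) n = w * coeff (E f) n" for n
    by (metis coeff_pcompose_linear coeff_smult)
  show ?thesis
  proof (cases "E f = 0")
    case True
    then show ?thesis by (intro exI[of _ 0]) (simp add: 1)
  next
    case False
    define k where "k = degree (E f)"
    have w: "w = 2 ^ k" using co[of k] False by (simp add: k_def)
    have inj: "n = k" if "(2 :: 'a) ^ n = 2 ^ k" for n
    proof -
      have "(of_nat (2 ^ n) :: 'a) = of_nat (2 ^ k)" using that by simp
      then have "(2 :: nat) ^ n = 2 ^ k" by (simp only: of_nat_eq_iff)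
      then show ?thesis by simp
    qed
    have "E f = monom (coeff (E f) k) k"
      by (rule poly_eqI) (use co w inj in \<open>auto\<close>)
    then have "poly (map_poly cS (E f)) l = cS (coeff (E f) k) * l ^ k"
      by (metis cS_simps(1) map_poly_monom poly_monom)
    then show ?thesis using w 1 by metis
  qed
qed

section \<open>Three lines through a point\<close>

text \<open>
  A homogeneous basis of the module of pairs \<open>(f, g)\<close> with \<open>P f g\<close>. Its two members \<open>(p b, q b)\<close> are
  indexed by a truth value; independence is expressed by the nonvanishing determinant.
\<close>

definition homog_basis where
  "homog_basis P p q w \<longleftrightarrow>
    (\<forall>b::bool. w b \<noteq> 0 \<and> homog (w b) (p b) \<and> homog (w b) (q b)) \<and>
    p True * q False - p False * q True \<noteq> 0 \<and>
    (\<forall>f g. P f g \<longleftrightarrow> (\<exists>s t. f = s * p True + t * p False \<and> g = s * q True + t * q False))"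

lemma homog_basis_unique:
  fixes s t :: "'a::field_char_0 S"
  assumes "homog_basis P p q w" and 0: "s * p True + t * p False = 0" "s * q True + t * q False = 0"
  shows "s = 0" "t = 0"
proof -
  have det: "p True * q False - p False * q True \<noteq> 0" using assms(1) by (simp add: homog_basis_def)
  have "s * (p True * q False - p False * q True) =
      q False * (s * p True + t * p False) - p False * (s * q True + t * q False)" by algebra
  then show "s = 0" using det unfolding 0 by simp
  have "t * (p True * q False - p False * q True) =
      p True * (s * q True + t * q False) - q True * (s * p True + t * p False)" by algebra
  then show "t = 0" using det unfolding 0 by simp
qed

text \<open>
  Polynomials in two of the three variables are those fixed by the substitution \<open>endo A B C\<close>, which
  sends the third variable to zero. The form \<open>L\<close> in these two variables vanishes on the line spanned by
  \<open>(p\<^sub>1, p\<^sub>2, p\<^sub>3)\<close>, and \<open>l\<close> is one of the two variables, serving as a coordinate on that line.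
\<close>

locale pencil =
  fixes A B C l L :: "'a::field_char_0 S" and p1 p2 p3 :: 'a
  assumes near: "L dvd A - cS p1 * l" "L dvd B - cS p2 * l" "L dvd C - cS p3 * l"
    and l: "homog 2 l" "endo A B C l = l" "endo (cS p1 * l) (cS p2 * l) (cS p3 * l) l = l"
    and L: "prime_elem L" "homog 2 L" "endo A B C L = L" "endo (cS p1 * l) (cS p2 * l) (cS p3 * l) L = 0"
begin

definition form :: "'a \<Rightarrow> 'a S \<Rightarrow> bool"
  where "form w f \<longleftrightarrow> homog w f \<and> endo A B C f = f"

abbreviation on_line :: "'a S \<Rightarrow> 'a S"
  where "on_line \<equiv> endo (cS p1 * l) (cS p2 * l) (cS p3 * l)"

lemma form_dvd_iff:
  assumes "endo A B C f = f"
  shows "L dvd f \<longleftrightarrow> on_line f = 0"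
proof
  assume "L dvd f"
  from ring_map_dvd[OF ring_map_endo this] show "on_line f = 0"
    using L(4) by (metis dvd_0_left)
next
  assume "on_line f = 0"
  then show "L dvd f" using endo_congruent[OF near, of f] assms by simp
qed

lemma form_mult: "form w f \<Longrightarrow> form v g \<Longrightarrow> form (w * v) (f * g)"
  by (simp add: form_def homog_mult)

lemma form_diff: "form w f \<Longrightarrow> form w g \<Longrightarrow> form w (f - g)"
  by (simp add: form_def homog_diff)

lemma form_power: "form w f \<Longrightarrow> form (w ^ n) (f ^ n)"
  by (simp add: form_def homog_power)

lemma form_0: "form w 0"
  by (simp add: form_def homog_0)

lemma form_L: "form 2 L"
  using L by (simp add: form_def)

lemma form_scale: "form w f \<Longrightarrow> form w (cS c * f)"
  by (simp add: form_def homog_scale)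

lemma L_nonzero: "L \<noteq> 0"
  using L by (simp add: prime_elem_def)

lemma form_cancel_L:
  assumes "form w (L ^ k * f)"
  shows "form (w / 2 ^ k) f"
proof -
  have "L ^ k * endo A B C f = L ^ k * f" using assms L(3) by (simp add: form_def)
  then have "endo A B C f = f" using L_nonzero by simp
  then show ?thesis
    using assms homog_cancel[OF homog_power[OF L(2)], of w k f] L_nonzero by (simp add: form_def)
qed

text \<open>
  Modulo \<open>L\<close> two forms become monomials in \<open>l\<close>, and of two monomials one divides the other.
\<close>

lemma form_comparable:
  assumes "form w r" "form w' r'" "w \<noteq> 0" "w' \<noteq> 0"
  shows "(\<exists>h. form (w' / w) h \<and> L dvd r' - h * r) \<or> (\<exists>h. form (w / w') h \<and> L dvd r - h * r')"
proof -
  have *: "\<exists>h. form (w' / w) h \<and> L dvd r' - h * r"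
    if r: "form w r" "form w' r'" and c: "on_line r = cS c * l ^ k" "on_line r' = cS c' * l ^ k'"
      and w: "w = 2 ^ k" "w' = 2 ^ k'" and "c \<noteq> 0" and "k \<le> k'" for r r' w w' c c' k k'
  proof -
    define h where "h = cS (c' / c) * l ^ (k' - k)"
    have "form (2 ^ (k' - k)) h"
      unfolding h_def by (intro form_scale form_power) (use l in \<open>simp add: form_def\<close>)
    moreover have "w' / w = 2 ^ (k' - k)"
      using w \<open>k \<le> k'\<close> by (simp add: power_diff)
    ultimately have h: "form (w' / w) h" by simp
    have "on_line (r' - h * r) = cS c' * l ^ k' - cS (c' / c) * l ^ (k' - k) * (cS c * l ^ k)"
      by (simp add: h_def l(3) c)
    also have "cS (c' / c) * l ^ (k' - k) * (cS c * l ^ k) = cS (c' / c * c) * (l ^ (k' - k) * l ^ k)"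
      by (simp only: cS_mult mult_ac)
    also have "\<dots> = cS c' * l ^ k'"
      using \<open>c \<noteq> 0\<close> \<open>k \<le> k'\<close> by (simp flip: power_add)
    finally have "on_line (r' - h * r) = 0" by simp
    then have "L dvd r' - h * r"
      using r h by (subst form_dvd_iff) (simp_all add: form_def)
    with h show ?thesis by blast
  qed
  obtain c k where c: "on_line r = cS c * l ^ k" "c \<noteq> 0 \<longrightarrow> w = 2 ^ k"
    using homog_on_line assms(1) unfolding form_def by blast
  obtain c' k' where c': "on_line r' = cS c' * l ^ k'" "c' \<noteq> 0 \<longrightarrow> w' = 2 ^ k'"
    using homog_on_line assms(2) unfolding form_def by blast
  consider "c = 0" | "c' = 0" | "c \<noteq> 0" "c' \<noteq> 0" "k \<le> k'" | "c \<noteq> 0" "c' \<noteq> 0" "k' \<le> k"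
    by linarith
  then show ?thesis
  proof cases
    case 1
    then have "L dvd r" using assms(1) c by (subst form_dvd_iff) (simp_all add: form_def)
    then show ?thesis using form_0 by (intro disjI2 exI[of _ 0]) simp
  next
    case 2
    then have "L dvd r'" using assms(2) c' by (subst form_dvd_iff) (simp_all add: form_def)
    then show ?thesis using form_0 by (intro disjI1 exI[of _ 0]) simp
  next
    case 3
    then show ?thesis using *[OF assms(1,2) c(1) c'(1)] c c' by blast
  next
    case 4
    then show ?thesis using *[OF assms(2,1) c'(1) c(1)] c c' by blast
  qed
qed

text \<open>
  For \<open>b = \<alpha>\<close> or \<open>b = -1\<close> this is the module of syzygies at one triple point: \<open>f\<close>, \<open>g\<close> and
  \<open>f - b g\<close> are the values of a derivation on the three forms through it.
\<close>

definition pencil_basis where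
  "pencil_basis X Y b m n k p q p' q' w w' \<longleftrightarrow>
     w \<noteq> 0 \<and> w' \<noteq> 0 \<and> form w p \<and> form w q \<and> form w' p' \<and> form w' q' \<and> p * q' - p' * q \<noteq> 0 \<and>
     (\<forall>f g. X ^ m dvd f \<and> Y ^ n dvd g \<and> L ^ k dvd f - cS b * g \<longleftrightarrow>
        (\<exists>s t. f = s * p + t * p' \<and> g = s * q + t * q'))"

lemma pencil_basis_swap:
  assumes "pencil_basis X Y b m n k p q p' q' w w'"
  shows "pencil_basis X Y b m n k p' q' p q w' w"
proof -
  have "p' * q - p * q' \<noteq> 0"
    using assms unfolding pencil_basis_def by (metis eq_iff_diff_eq_0)
  moreover have "(\<exists>s t. f = s * p + t * p' \<and> g = s * q + t * q') \<longleftrightarrow>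
     (\<exists>s t. f = s * p' + t * p \<and> g = s * q' + t * q)" for f g
    by (metis add.commute)
  ultimately show ?thesis
    using assms unfolding pencil_basis_def by simp
qed

text \<open>
  Raising the exponent of \<open>L\<close> by one imposes on the pair with coordinates \<open>(s, t)\<close> the condition
  that \<open>L\<close> divides \<open>s r + t r'\<close>. Replacing the second basis element by its difference with \<open>h\<close> times the
  first makes \<open>r'\<close> divisible by \<open>L\<close>; the condition then concerns the first coordinate
  \<open>s + t h\<close> only, and is met by multiplying the first basis element by \<open>L\<close>.
\<close>

lemma pencil_basis_step:
  assumes basis: "pencil_basis X Y b m n k p q p' q' w w'"
    and r: "p - cS b * q = L ^ k * r" "p' - cS b * q' = L ^ k * r'"
    and h: "form (w' / w) h" "L dvd r' - h * r"
  shows "\<exists>p q p' q' w w'. pencil_basis X Y b m n (Suc k) p q p' q' w w'"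
proof -
  have w: "w \<noteq> 0" "w' \<noteq> 0" and forms: "form w p" "form w q" "form w' p'" "form w' q'"
    and det: "p * q' - p' * q \<noteq> 0"
    and span: "\<And>f g. X ^ m dvd f \<and> Y ^ n dvd g \<and> L ^ k dvd f - cS b * g \<longleftrightarrow>
        (\<exists>s t. f = s * p + t * p' \<and> g = s * q + t * q')"
    using basis by (simp_all add: pencil_basis_def)
  have val: "s * p + t * p' - cS b * (s * q + t * q') = L ^ k * (s * r + t * r')" for s t
  proof -
    have "s * p + t * p' - cS b * (s * q + t * q') = s * (p - cS b * q) + t * (p' - cS b * q')"
      by (simp add: algebra_simps)
    also have "\<dots> = L ^ k * (s * r + t * r')" unfolding r by (simp add: algebra_simps)
    finally show ?thesis .
  qed
  have dvd: "L ^ Suc k dvd s * p + t * p' - cS b * (s * q + t * q') \<longleftrightarrow> L dvd s * r + t * r'" for s t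
    unfolding val using L_nonzero by (simp add: mult.commute[of L])
  have Suc: "X ^ m dvd f \<and> Y ^ n dvd g \<and> L ^ Suc k dvd f - cS b * g \<longleftrightarrow>
        (\<exists>s t. f = s * p + t * p' \<and> g = s * q + t * q' \<and> L dvd s * r + t * r')" (is "?l \<longleftrightarrow> ?r") for f g
  proof
    assume ?l
    then have "X ^ m dvd f \<and> Y ^ n dvd g \<and> L ^ k dvd f - cS b * g"
      by (metis dvd_mult_right power_Suc)
    with span obtain s t where "f = s * p + t * p'" "g = s * q + t * q'" by blast
    with \<open>?l\<close> dvd show ?r by blast
  next
    assume ?r
    with span dvd show ?l by blast
  qed
  have split: "s * r + t * r' = (s + t * h) * r + t * (r' - h * r)" for s t
    by (simp add: algebra_simps)
  show ?thesis
  proof (cases "L dvd r")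
    case True
    then have "L dvd r'" using h(2) by (metis dvd_diff_left_iff dvd_mult)
    with True have "L dvd s * r + t * r'" for s t by simp
    then have "pencil_basis X Y b m n (Suc k) p q p' q' w w'"
      using w forms det unfolding pencil_basis_def Suc by simp
    then show ?thesis by blast
  next
    case False
    have dvd': "L dvd s * r + t * r' \<longleftrightarrow> L dvd s + t * h" for s t
    proof -
      have "L dvd s * r + t * r' \<longleftrightarrow> L dvd (s + t * h) * r"
        unfolding split using h(2) by (simp add: dvd_add_left_iff)
      then show ?thesis using False L(1) by (simp add: prime_elem_dvd_mult_iff)
    qed
    have "(\<exists>s t. f = s * p + t * p' \<and> g = s * q + t * q' \<and> L dvd s * r + t * r') \<longleftrightarrow>
      (\<exists>s t. f = s * (p' - h * p) + t * (L * p) \<and> g = s * (q' - h * q) + t * (L * q))" (is "?l \<longleftrightarrow> ?r") for f g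
    proof
      assume ?l
      then obtain s t where st: "f = s * p + t * p'" "g = s * q + t * q'" "L dvd s + t * h"
        using dvd' by blast
      then obtain u where "s + t * h = L * u" by (elim dvdE)
      then have "s = L * u - t * h" by (simp add: eq_diff_eq)
      with st have "f = t * (p' - h * p) + u * (L * p)" "g = t * (q' - h * q) + u * (L * q)"
        by (simp_all add: algebra_simps)
      then show ?r by blast
    next
      assume ?r
      then obtain s t where "f = s * (p' - h * p) + t * (L * p)" "g = s * (q' - h * q) + t * (L * q)"
        by blast
      then have "f = (t * L - s * h) * p + s * p'" "g = (t * L - s * h) * q + s * q'"
        by (simp_all add: algebra_simps)
      moreover have "L dvd (t * L - s * h) * r + s * r'" unfolding dvd' by simp
      ultimately show ?l by blast
    qed
    moreover have "form w' (h * p)" "form w' (h * q)"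
      using form_mult[OF h(1)] forms w by fastforce+
    then have "form w' (p' - h * p)" "form w' (q' - h * q)"
      using forms by (simp_all add: form_diff)
    moreover have "form (2 * w) (L * p)" "form (2 * w) (L * q)"
      using forms form_L by (simp_all add: form_mult)
    moreover have "(p' - h * p) * (L * q) - (L * p) * (q' - h * q) = - L * (p * q' - p' * q)"
      by (simp add: algebra_simps)
    then have "(p' - h * p) * (L * q) - (L * p) * (q' - h * q) \<noteq> 0"
      using det L_nonzero by simp
    ultimately have "pencil_basis X Y b m n (Suc k) (p' - h * p) (q' - h * q) (L * p) (L * q) w' (2 * w)"
      using w unfolding pencil_basis_def Suc by simp
    then show ?thesis by blast
  qed
qed

lemma pencil_basis_exists:
  assumes X: "form 2 X" "X \<noteq> 0" and Y: "form 2 Y" "Y \<noteq> 0"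
  shows "\<exists>p q p' q' w w'. pencil_basis X Y b m n k p q p' q' w w'"
proof (induction k)
  case 0
  have "(X ^ m dvd f \<and> Y ^ n dvd g \<and> L ^ 0 dvd f - cS b * g) \<longleftrightarrow>
        (\<exists>s t. f = s * X ^ m + t * 0 \<and> g = s * 0 + t * Y ^ n)" for f g
    by (auto simp: dvd_def mult.commute)
  then have "pencil_basis X Y b m n 0 (X ^ m) 0 0 (Y ^ n) (2 ^ m) (2 ^ n)"
    using assms form_power form_0 unfolding pencil_basis_def by simp
  then show ?case by blast
next
  case (Suc k)
  then obtain p q p' q' w w' where basis: "pencil_basis X Y b m n k p q p' q' w w'" by blast
  note swapped = pencil_basis_swap[OF basis]
  have w: "w \<noteq> 0" "w' \<noteq> 0" and forms: "form w p" "form w q" "form w' p'" "form w' q'"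
    and span: "\<And>f g. X ^ m dvd f \<and> Y ^ n dvd g \<and> L ^ k dvd f - cS b * g \<longleftrightarrow>
        (\<exists>s t. f = s * p + t * p' \<and> g = s * q + t * q')"
    using basis by (simp_all add: pencil_basis_def)
  have "\<exists>s t. p = s * p + t * p' \<and> q = s * q + t * q'" by (rule exI[of _ 1], rule exI[of _ 0]) simp
  with span obtain r where r: "p - cS b * q = L ^ k * r" by (meson dvdE)
  have "\<exists>s t. p' = s * p + t * p' \<and> q' = s * q + t * q'" by (rule exI[of _ 0], rule exI[of _ 1]) simp
  with span obtain r' where r': "p' - cS b * q' = L ^ k * r'" by (meson dvdE)
  have "form (w / 2 ^ k) r" "form (w' / 2 ^ k) r'"
    using form_cancel_L r r' form_diff form_scale forms by metis+
  from form_comparable[OF this] w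
  have "(\<exists>h. form (w' / w) h \<and> L dvd r' - h * r) \<or> (\<exists>h. form (w / w') h \<and> L dvd r - h * r')"
    by simp
  then show ?case
    using pencil_basis_step[OF basis r r'] pencil_basis_step[OF swapped r' r] by blast
qed

lemma homog_basis_exists:
  assumes X: "form 2 X" "X \<noteq> 0" and Y: "form 2 Y" "Y \<noteq> 0"
  shows "\<exists>p q w. homog_basis (\<lambda>f g. X ^ m dvd f \<and> Y ^ n dvd g \<and> L ^ k dvd f - cS b * g) p q w"
proof -
  obtain p q p' q' w w' where *: "pencil_basis X Y b m n k p q p' q' w w'"
    using pencil_basis_exists[OF assms] by blast
  let ?c = "\<lambda>u v b. if b then u else v"
  have "homog_basis (\<lambda>f g. X ^ m dvd f \<and> Y ^ n dvd g \<and> L ^ k dvd f - cS b * g)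
      (?c p p') (?c q q') (?c w w')"
    using * unfolding pencil_basis_def homog_basis_def form_def by simp
  then show ?thesis by blast
qed

end

section \<open>Kernels of surjective homogeneous matrices\<close>

text \<open>
  The \<open>i\<close>-th column has weight \<open>w i\<close> and the \<open>r\<close>-th row weight \<open>\<omega> r\<close>. The coordinates in \<open>J\<close>
  parametrize the kernel. In the induction, a new row is restricted to the kernel of the old ones, where it
  becomes \<open>\<Sum>j\<in>J. B j * s j\<close>. As the matrix is onto, this linear form takes the value \<open>1\<close>, so some \<open>B j\<^sub>0\<close>
  has a nonzero constant term and, being homogeneous, is a constant: it serves as a pivot that
  eliminates \<open>s j\<^sub>0\<close>. The homogeneity of \<open>G\<close> is what keeps the induction going.
\<close>

lemma homogeneous_kernel:
  fixes A :: "'r \<Rightarrow> 'i \<Rightarrow> 'a::field_char_0 S" and \<omega> :: "'r \<Rightarrow> 'a" and w :: "'i \<Rightarrow> 'a"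
  assumes "finite R" and I: "finite I" and w: "\<And>i. i \<in> I \<Longrightarrow> w i \<noteq> 0"
    and "\<And>r i. r \<in> R \<Longrightarrow> i \<in> I \<Longrightarrow> homog (\<omega> r * w i) (A r i)"
    and "\<And>c. \<exists>s. \<forall>r\<in>R. (\<Sum>i\<in>I. A r i * s i) = c r"
  shows "\<exists>J G. J \<subseteq> I \<and> (\<forall>i\<in>I - J. \<forall>j\<in>J. homog (w j / w i) (G i j)) \<and>
    (\<forall>s. (\<forall>r\<in>R. (\<Sum>i\<in>I. A r i * s i) = 0) \<longleftrightarrow> (\<forall>i\<in>I - J. s i = (\<Sum>j\<in>J. G i j * s j)))"
  using assms(1,4,5)
proof (induction R rule: finite_induct)
  case empty
  show ?case by (intro exI[of _ I] exI[of _ undefined]) simp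
next
  case (insert r0 R)
  have surj: "\<exists>s. \<forall>r\<in>R. (\<Sum>i\<in>I. A r i * s i) = c r" for c
    using insert.prems(2)[of c] by blast
  have hom: "homog (\<omega> r * w i) (A r i)" if "r \<in> R" "i \<in> I" for r i
    using insert.prems(1) that by blast
  have "\<exists>J G. J \<subseteq> I \<and> (\<forall>i\<in>I - J. \<forall>j\<in>J. homog (w j / w i) (G i j)) \<and>
    (\<forall>s. (\<forall>r\<in>R. (\<Sum>i\<in>I. A r i * s i) = 0) \<longleftrightarrow> (\<forall>i\<in>I - J. s i = (\<Sum>j\<in>J. G i j * s j)))"
    by (rule insert.IH) (fact hom surj)+
  then obtain J G where J: "J \<subseteq> I"
    and G': "\<forall>i\<in>I - J. \<forall>j\<in>J. homog (w j / w i) (G i j)"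
    and ker': "\<forall>s. (\<forall>r\<in>R. (\<Sum>i\<in>I. A r i * s i) = 0) \<longleftrightarrow> (\<forall>i\<in>I - J. s i = (\<Sum>j\<in>J. G i j * s j))"
    by (elim exE conjE)
  note ker = ker'[THEN spec]
  have G: "homog (w j / w i) (G i j)" if "i \<in> I - J" "j \<in> J" for i j
    using G' that by blast
  have fJ: "finite J" using J I by (rule finite_subset)
  define B where "B j = A r0 j + (\<Sum>i\<in>I - J. A r0 i * G i j)" for j
  have row: "(\<Sum>i\<in>I. A r0 i * s i) = (\<Sum>j\<in>J. B j * s j)"
    if "\<forall>i\<in>I - J. s i = (\<Sum>j\<in>J. G i j * s j)" for s
  proof -
    have "(\<Sum>i\<in>I. A r0 i * s i) = (\<Sum>i\<in>J. A r0 i * s i) + (\<Sum>i\<in>I - J. A r0 i * s i)"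
      by (subst add.commute) (rule sum.subset_diff[OF J I])
    also have "(\<Sum>i\<in>I - J. A r0 i * s i) = (\<Sum>i\<in>I - J. \<Sum>j\<in>J. A r0 i * G i j * s j)"
      using that by (simp add: sum_distrib_left mult.assoc)
    also have "\<dots> = (\<Sum>j\<in>J. (\<Sum>i\<in>I - J. A r0 i * G i j) * s j)"
      by (subst sum.swap) (simp add: sum_distrib_right)
    finally show ?thesis by (simp add: B_def sum.distrib distrib_right)
  qed
  have homB: "homog (\<omega> r0 * w j) (B j)" if j: "j \<in> J" for j
    unfolding B_def
  proof (intro homog_add homog_sum)
    show "homog (\<omega> r0 * w j) (A r0 j)" using insert.prems(1) j J by blast
    fix i assume i: "i \<in> I - J"
    then have "homog (\<omega> r0 * w i * (w j / w i)) (A r0 i * G i j)"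
      using insert.prems(1) G j by (intro homog_mult) auto
    then show "homog (\<omega> r0 * w j) (A r0 i * G i j)" using w[of i] i by simp
  qed
  obtain s where "\<forall>r\<in>insert r0 R. (\<Sum>i\<in>I. A r i * s i) = (if r = r0 then 1 else 0)"
    using insert.prems(2)[of "\<lambda>r. if r = r0 then 1 else 0"] by blast
  then have s: "\<forall>r\<in>R. (\<Sum>i\<in>I. A r i * s i) = 0" "(\<Sum>i\<in>I. A r0 i * s i) = 1"
    using insert.hyps(2) by auto
  have "(\<Sum>j\<in>J. B j * s j) = 1" using row[OF iffD1[OF ker s(1)]] s(2) by simp
  then have "const_term (\<Sum>j\<in>J. B j * s j) = const_term 1" by simp
  then have one: "(\<Sum>j\<in>J. const_term (B j) * const_term (s j)) = 1"
    by (simp add: ring_map_sum[OF ring_map_const_term] ring_mapD(1)[OF ring_map_const_term])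
  have "\<exists>j0\<in>J. const_term (B j0) \<noteq> 0"
  proof (rule ccontr)
    assume "\<not> (\<exists>j0\<in>J. const_term (B j0) \<noteq> 0)"
    then show False using one by simp
  qed
  then obtain j0 where j0: "j0 \<in> J" "const_term (B j0) \<noteq> 0" by blast
  define c where "c = const_term (B j0)"
  have c: "c \<noteq> 0" "B j0 = cS c" "\<omega> r0 * w j0 = 1"
    using homog_unit[OF homB[OF j0(1)] j0(2)] j0(2) by (simp_all add: c_def)
  \<comment> \<open>the new row determines coordinate \<open>j0\<close>, which is then substituted everywhere\<close>
  define J' where "J' = J - {j0}"
  define G' where "G' i j = (if i = j0 then - (cS (1 / c) * B j) else G i j - G i j0 * (cS (1 / c) * B j))" for i j
  have "J' \<subseteq> I" using J by (auto simp: J'_def)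
  moreover have "homog (w j / w i) (G' i j)" if i: "i \<in> I - J'" and j: "j \<in> J'" for i j
  proof -
    have ww: "w j / w j0 = \<omega> r0 * w j" using c(3) w[of j0] J j0(1) by (auto simp: field_simps)
    have hj: "homog (\<omega> r0 * w j) (cS (1 / c) * B j)" using homB j by (intro homog_scale) (auto simp: J'_def)
    show ?thesis
    proof (cases "i = j0")
      case True
      then show ?thesis using hj by (simp add: G'_def ww homog_minus)
    next
      case False
      then have i': "i \<in> I - J" using i by (auto simp: J'_def)
      have "homog (w j0 / w i * (\<omega> r0 * w j)) (G i j0 * (cS (1 / c) * B j))"
        using G[OF i' j0(1)] hj by (rule homog_mult)
      moreover have "w j0 / w i * (\<omega> r0 * w j) = w j / w i * (\<omega> r0 * w j0)"
        by simp
      ultimately have "homog (w j / w i) (G i j0 * (cS (1 / c) * B j))"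
        by (simp only: c(3) mult_1_right)
      moreover have "homog (w j / w i) (G i j)" using G i' j by (auto simp: J'_def)
      ultimately show ?thesis using False by (simp add: G'_def homog_diff)
    qed
  qed
  moreover have "(\<forall>r\<in>insert r0 R. (\<Sum>i\<in>I. A r i * s i) = 0) \<longleftrightarrow> (\<forall>i\<in>I - J'. s i = (\<Sum>j\<in>J'. G' i j * s j))" for s
  proof -
    have split: "(\<Sum>j\<in>J. f j) = f j0 + (\<Sum>j\<in>J'. f j)" for f :: "'i \<Rightarrow> 'a S"
      unfolding J'_def using fJ j0(1) by (rule sum.remove)
    define T where "T = (\<Sum>j\<in>J'. B j * s j)"
    have T: "(\<Sum>j\<in>J'. G' j0 j * s j) = - (cS (1 / c) * T)"
      by (simp add: G'_def T_def sum_distrib_left sum_negf mult.assoc)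
    have c1: "cS c * s j0 + T = 0 \<longleftrightarrow> s j0 = - (cS (1 / c) * T)"
    proof -
      have 1: "cS c * cS (1 / c) = 1" using c(1) by (simp flip: cS_mult)
      have "cS c * s j0 + T = cS c * (s j0 + cS (1 / c) * T)"
        by (simp add: distrib_left 1 flip: mult.assoc)
      then show ?thesis using c(1) by (simp add: eq_neg_iff_add_eq_0)
    qed
    have others: "(\<Sum>j\<in>J'. G' i j * s j) = (\<Sum>j\<in>J'. G i j * s j) - G i j0 * (cS (1 / c) * T)"
      if "i \<in> I - J" for i
    proof -
      have "i \<noteq> j0" using that j0 by blast
      then show ?thesis
        by (simp add: G'_def T_def left_diff_distrib sum_subtractf sum_distrib_left mult.assoc)
    qed
    let ?K = "\<forall>i\<in>I - J. s i = (\<Sum>j\<in>J. G i j * s j)" and ?s = "- (cS (1 / c) * T)"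
    have "(\<forall>r\<in>insert r0 R. (\<Sum>i\<in>I. A r i * s i) = 0) \<longleftrightarrow> (\<Sum>i\<in>I. A r0 i * s i) = 0 \<and> ?K"
      unfolding ball_simps ker ..
    also have "\<dots> \<longleftrightarrow> ?K \<and> (\<Sum>j\<in>J. B j * s j) = 0"
    proof (cases ?K)
      case True
      from row[OF this] show ?thesis by (simp only: conj_commute)
    next
      case False
      then show ?thesis by (simp only: simp_thms)
    qed
    also have "\<dots> \<longleftrightarrow> ?K \<and> s j0 = ?s"
      unfolding split[of "\<lambda>j. B j * s j"] c(2) T_def[symmetric] c1 ..
    also have "\<dots> \<longleftrightarrow> (\<forall>i\<in>I - J. s i = (\<Sum>j\<in>J'. G' i j * s j)) \<and> s j0 = (\<Sum>j\<in>J'. G' j0 j * s j)"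
    proof (cases "s j0 = ?s")
      case True
      have "(\<Sum>j\<in>J. G i j * s j) = (\<Sum>j\<in>J'. G' i j * s j)" if "i \<in> I - J" for i
        unfolding split others[OF that] True by (simp add: algebra_simps)
      then have "?K \<longleftrightarrow> (\<forall>i\<in>I - J. s i = (\<Sum>j\<in>J'. G' i j * s j))"
        by (intro ball_cong refl) (simp only:)
      then show ?thesis unfolding T by (simp only:)
    next
      case False
      then show ?thesis unfolding T by (simp only: simp_thms)
    qed
    also have "\<dots> \<longleftrightarrow> (\<forall>i\<in>I - J'. s i = (\<Sum>j\<in>J'. G' i j * s j))"
    proof -
      have "I - J' = insert j0 (I - J)" using j0(1) J by (auto simp: J'_def)
      then show ?thesis unfolding ball_simps by (simp only: ball_simps conj_commute)
    qed
    finally show ?thesis .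
  qed
  ultimately show ?case by blast
qed

section \<open>Derivations and cochains\<close>

definition derivation :: "('r::comm_ring_1 \<Rightarrow> 'r) \<Rightarrow> bool"
  where "derivation d \<longleftrightarrow> (\<forall>p q. d (p + q) = d p + d q) \<and> (\<forall>p q. d (p * q) = p * d q + q * d p)"

lemma derivationD:
  assumes "derivation d"
  shows "d (p + q) = d p + d q" "d (p * q) = p * d q + q * d p" "d 0 = 0" "d 1 = 0"
proof -
  show *: "d (p + q) = d p + d q" "d (p * q) = p * d q + q * d p" for p q
    using assms by (auto simp: derivation_def)
  show "d 0 = 0" using *(1)[of 0 0] by simp
  show "d 1 = 0" using *(2)[of 1 1] by simp
qed

lemma derivation_pderiv: "derivation (pderiv :: 'r::idom poly \<Rightarrow> _)"
  by (simp add: derivation_def pderiv_add pderiv_mult)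

lemma derivation_map_poly:
  assumes "derivation d"
  shows "derivation (map_poly d)"
proof -
  note d = derivationD[OF assms]
  have add: "map_poly d (p + q) = map_poly d p + map_poly d q" for p q
    by (rule map_poly_add_hom) (simp_all add: d)
  have sm: "map_poly d (smult c q) = smult c (map_poly d q) + smult (d c) q" for c q
    by (rule poly_eqI) (simp add: coeff_map_poly d)
  have "map_poly d (p * q) = p * map_poly d q + q * map_poly d p" for p q
  proof (induction p)
    case (pCons a p)
    then show ?case
      by (simp add: map_poly_pCons d add sm algebra_simps)
  qed simp
  then show ?thesis by (simp add: derivation_def add)
qed

text \<open>
  The derivation with prescribed values on the three variables, assembled from the partial
  derivatives: with the variable \<open>z\<close> outermost, the derivative by \<open>z\<close> is \<open>pderiv\<close>, and those by \<open>y\<close> and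
  \<open>x\<close> act on coefficients.
\<close>

definition der :: "'a::field_char_0 S \<Rightarrow> 'a S \<Rightarrow> 'a S \<Rightarrow> 'a S \<Rightarrow> 'a S"
  where "der f g h p = map_poly (map_poly pderiv) p * f + map_poly pderiv p * g + pderiv p * h"

lemma der_gens [simp]:
  "der f g h (cS c) = 0" "der f g h xS = f" "der f g h yS = g" "der f g h zS = h"
  by (simp_all add: der_def cS_def xS_def yS_def zS_def map_poly_pCons pderiv_pCons
     pCons_one map_poly_1)

lemma derivation_der: "derivation (der f g h)"
proof -
  have "derivation (map_poly (map_poly pderiv) :: 'a S \<Rightarrow> _)" "derivation (map_poly pderiv :: 'a S \<Rightarrow> _)"
      "derivation (pderiv :: 'a S \<Rightarrow> _)"
    by (intro derivation_map_poly derivation_pderiv)+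
  then show ?thesis
    by (simp add: derivation_def der_def algebra_simps)
qed

lemma der_in_Der: "der f g h \<in> Der"
  using derivation_der[of f g h]
  by (simp add: Der_def derivation_def)

lemma Der_const:
  assumes "\<theta> \<in> Der"
  shows "\<theta> (cS c) = 0"
proof -
  have "derivation \<theta>" "\<theta> (cS c * 1) = cS c * \<theta> 1" using assms by (auto simp: Der_def derivation_def simp del: mult_1_right)
  then show ?thesis by (simp add: derivationD)
qed

lemma Der_eq_der:
  assumes "\<theta> \<in> Der"
  shows "\<theta> p = der (\<theta> xS) (\<theta> yS) (\<theta> zS) p"
proof (induction p rule: S_induct)
  case (add p q)
  then show ?case using assms by (simp add: derivationD[OF derivation_der] Der_def)
next
  case (mult p q)
  then show ?case using assms by (simp add: derivationD[OF derivation_der] Der_def)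
qed (simp_all add: Der_const assms)
lemma J_plane_iff: "p \<in> J_plane a m H \<longleftrightarrow> lform a H ^ m H dvd p"
  by (auto simp: J_plane_def dvd_def)

lemma cochain1_iff: "f \<in> cochain1 a m \<longleftrightarrow> (\<forall>H. lform a H ^ m H dvd f H)"
  by (simp add: cochain1_def J_plane_iff)

lemma D_X3_iff: "\<theta> \<in> D_X3 a m \<longleftrightarrow> \<theta> \<in> Der \<and> (\<forall>H. lform a H ^ m H dvd \<theta> (lform a H))"
  by (simp add: D_X3_def J_plane_iff)

lemma all_plane: "(\<forall>H. P H) \<longleftrightarrow> P H1 \<and> P H2 \<and> P H3 \<and> P H4 \<and> P H5 \<and> P H6"
  by (metis plane.exhaust)

lemma all_triple_point: "(\<forall>Y. P Y) \<longleftrightarrow> P Y1 \<and> P Y2 \<and> P Y3"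
  by (metis triple_point.exhaust)

lemma Der_lform:
  assumes "\<theta> \<in> Der"
  shows "\<theta> (xS - cS a * yS) = \<theta> xS - cS a * \<theta> yS"
    "\<theta> (xS + zS) = \<theta> xS + \<theta> zS" "\<theta> (yS + zS) = \<theta> yS + \<theta> zS"
proof -
  have add: "\<theta> (p + q) = \<theta> p + \<theta> q" and sc: "\<theta> (cS c * p) = cS c * \<theta> p" for p q c
    using assms by (auto simp: Der_def)
  show "\<theta> (xS + zS) = \<theta> xS + \<theta> zS" "\<theta> (yS + zS) = \<theta> yS + \<theta> zS" by (rule add)+
  have "\<theta> xS = \<theta> ((xS - cS a * yS) + cS a * yS)" by simp
  also have "\<dots> = \<theta> (xS - cS a * yS) + cS a * \<theta> yS" unfolding add sc ..
  finally show "\<theta> (xS - cS a * yS) = \<theta> xS - cS a * \<theta> yS" by simp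
qed

lemma delta1_simps:
  "delta1 a f Y1 = f H1 - cS a * f H2 - f H4"
  "delta1 a f Y2 = f H1 + f H3 - f H5"
  "delta1 a f Y3 = f H2 + f H3 - f H6"
  by (simp_all add: delta1_def UNIV_plane cS_minus)

lemma J_triple_iff:
  assumes "a \<noteq> 0"
  shows "p \<in> J_triple a m Y1 \<longleftrightarrow> (\<exists>r s t. p = xS ^ m H1 * r + yS ^ m H2 * s + (xS - cS a * yS) ^ m H4 * t)"
    "p \<in> J_triple a m Y2 \<longleftrightarrow> (\<exists>r s t. p = xS ^ m H1 * r + zS ^ m H3 * s + (xS + zS) ^ m H5 * t)"
    "p \<in> J_triple a m Y3 \<longleftrightarrow> (\<exists>r s t. p = yS ^ m H2 * r + zS ^ m H3 * s + (yS + zS) ^ m H6 * t)"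
proof -
  have "p \<in> J_triple a m Y \<longleftrightarrow> (\<exists>r s t. p = lform a A ^ m A * r + lform a B ^ m B * s + lform a C ^ m C * t)"
    if Y: "planes_through a Y = {A, B, C}" and d: "A \<noteq> B" "A \<noteq> C" "B \<noteq> C" for Y A B C
  proof
    assume "p \<in> J_triple a m Y"
    then show "\<exists>r s t. p = lform a A ^ m A * r + lform a B ^ m B * s + lform a C ^ m C * t"
      using d by (simp add: J_triple_def Y J_plane_def add.assoc) metis
  next
    assume "\<exists>r s t. p = lform a A ^ m A * r + lform a B ^ m B * s + lform a C ^ m C * t"
    then obtain r s t where p: "p = lform a A ^ m A * r + lform a B ^ m B * s + lform a C ^ m C * t" by blast
    define f where "f H = lform a H ^ m H * (if H = A then r else if H = B then s else t)" for H
    have "p = (\<Sum>H\<in>planes_through a Y. f H)" using d by (auto simp: p f_def Y)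
    moreover have "\<forall>H. f H \<in> J_plane a m H" by (simp add: J_plane_iff f_def)
    ultimately show "p \<in> J_triple a m Y" unfolding J_triple_def by blast
  qed
  from this[OF planes_through_simps(1)[OF assms]] this[OF planes_through_simps(2)[OF assms]]
    this[OF planes_through_simps(3)[OF assms]]
  show "p \<in> J_triple a m Y1 \<longleftrightarrow> (\<exists>r s t. p = xS ^ m H1 * r + yS ^ m H2 * s + (xS - cS a * yS) ^ m H4 * t)"
    "p \<in> J_triple a m Y2 \<longleftrightarrow> (\<exists>r s t. p = xS ^ m H1 * r + zS ^ m H3 * s + (xS + zS) ^ m H5 * t)"
    "p \<in> J_triple a m Y3 \<longleftrightarrow> (\<exists>r s t. p = yS ^ m H2 * r + zS ^ m H3 * s + (yS + zS) ^ m H6 * t)"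
    by simp_all
qed

definition coboundaries :: "'a::field_char_0 \<Rightarrow> (plane \<Rightarrow> nat) \<Rightarrow> (triple_point \<Rightarrow> 'a S) set"
  where "coboundaries a m = delta1 a ` cochain1 a m"

lemma coboundaries_add:
  assumes "u \<in> coboundaries a m" "v \<in> coboundaries a m"
  shows "u + v \<in> coboundaries a m"
proof -
  obtain f g where fg: "f \<in> cochain1 a m" "g \<in> cochain1 a m" and "u = delta1 a f" "v = delta1 a g"
    using assms unfolding coboundaries_def by blast
  then have "u + v = delta1 a (f + g)"
    by (simp add: fun_eq_iff delta1_def sum.distrib distrib_left)
  moreover have "f + g \<in> cochain1 a m" using fg by (simp add: cochain1_iff)
  ultimately show ?thesis unfolding coboundaries_def by blast
qed

lemma coboundaries_smul:
  assumes "u \<in> coboundaries a m"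
  shows "smul p u \<in> coboundaries a m"
proof -
  obtain f where f: "f \<in> cochain1 a m" and "u = delta1 a f"
    using assms unfolding coboundaries_def by blast
  then have "smul p u = delta1 a (smul p f)"
    by (simp add: fun_eq_iff smul_def delta1_def sum_distrib_left mult.left_commute)
  moreover have "smul p f \<in> cochain1 a m" using f by (simp add: cochain1_iff smul_def)
  ultimately show ?thesis unfolding coboundaries_def by blast
qed

lemma coboundaries_diff:
  assumes "u \<in> coboundaries a m" "v \<in> coboundaries a m"
  shows "u - v \<in> coboundaries a m"
proof -
  have "u - v = u + smul (- 1) v" by (simp add: smul_def fun_eq_iff)
  then show ?thesis using assms by (simp only: coboundaries_add coboundaries_smul)
qed

lemma zero_in_cochain2: "0 \<in> cochain2 a m"
proof -
  have "0 \<in> J_triple a m Y" for Y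
    unfolding J_triple_def by (rule CollectI, rule exI[of _ 0]) (simp add: J_plane_iff)
  then show ?thesis by (simp add: cochain2_def)
qed

lemma cohomology2_trivial_iff:
  "cohomology2 a m = {cohomology2_zero a m} \<longleftrightarrow> cochain2 a m \<subseteq> coboundaries a m"
proof -
  let ?N = "cochain2 a m" and ?I = "coboundaries a m"
  have cls: "mod_rel ?N ?I `` {v} = mod_rel ?N ?I `` {0} \<longleftrightarrow> v \<in> ?I" if "v \<in> ?N" for v
  proof
    have "0 \<in> cochain1 a m" "delta1 a 0 = 0"
      by (simp_all add: cochain1_iff delta1_def fun_eq_iff)
    then have "0 \<in> ?I" unfolding coboundaries_def by (intro image_eqI[of _ _ 0]) simp_all
    then have "v \<in> mod_rel ?N ?I `` {v}" using that by (auto simp: mod_rel_def)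
    moreover assume "mod_rel ?N ?I `` {v} = mod_rel ?N ?I `` {0}"
    ultimately have "0 - v \<in> ?I" by (auto simp: mod_rel_def)
    from coboundaries_diff[OF \<open>0 \<in> ?I\<close> this] show "v \<in> ?I" by simp
  next
    assume v: "v \<in> ?I"
    have "v - u \<in> ?I \<longleftrightarrow> 0 - u \<in> ?I" for u
    proof
      show "v - u \<in> ?I" if "0 - u \<in> ?I" using coboundaries_add[OF v that] by simp
      show "0 - u \<in> ?I" if "v - u \<in> ?I" using coboundaries_diff[OF that v] by simp
    qed
    then show "mod_rel ?N ?I `` {v} = mod_rel ?N ?I `` {0}"
      using that zero_in_cochain2[of a m] unfolding mod_rel_def Image_singleton by (simp only: mem_Collect_eq case_prod_conv simp_thms)
  qed
  have singleton_image: "f ` N = {c} \<longleftrightarrow> (\<forall>v\<in>N. f v = c)" if "n \<in> N"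
    for f :: "'b \<Rightarrow> 'c" and N n c
    using that by auto
  have "cohomology2 a m = (\<lambda>v. mod_rel ?N ?I `` {v}) ` ?N"
    unfolding cohomology2_def quotient_def coboundaries_def by (rule UNION_singleton_eq_range)
  moreover have "cohomology2_zero a m = mod_rel ?N ?I `` {0}"
    by (simp add: cohomology2_zero_def coboundaries_def)
  ultimately have "cohomology2 a m = {cohomology2_zero a m} \<longleftrightarrow> (\<forall>v\<in>?N. mod_rel ?N ?I `` {v} = mod_rel ?N ?I `` {0})"
    using singleton_image[OF zero_in_cochain2[of a m]] by simp
  then show ?thesis using cls by (auto simp: subset_iff)
qed

section \<open>A free module of multiderivations has vanishing cohomology\<close>

text \<open>
  Regularity of \<open>u\<^sub>2\<close> modulo \<open>u\<^sub>1\<close> inside the principal ideal generated by \<open>c\<close>, which is free of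
  rank one.
\<close>

lemma koszul_quotient:
  fixes s1 s2 :: "'r::idom"
  assumes "regular_triple u1 u2 u3" and c: "c \<noteq> 0" "c dvd s1" "c dvd s2" and eq: "u1 * s2 = u2 * s1"
  shows "\<exists>t. c dvd t \<and> s1 = u1 * t"
proof -
  obtain t1 t2 where t: "s1 = c * t1" "s2 = c * t2" using c by (meson dvdE)
  have "c * (u1 * t2) = c * (u2 * t1)"
    using eq unfolding t by (simp only: mult_ac)
  then have "u1 * t2 = u2 * t1" using c(1) by simp
  then have "u1 dvd t1" using assms(1) unfolding regular_triple_def by (metis dvd_triv_left)
  then obtain t where "t1 = u1 * t" by (elim dvdE)
  then have "s1 = u1 * (c * t)" unfolding t by (simp only: mult_ac)
  then show ?thesis by (metis dvd_triv_left)
qed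

lemma delta1_diff: "delta1 a (f - g) = delta1 a f - delta1 a g"
  by (simp add: fun_eq_iff delta1_def sum_subtractf right_diff_distrib)

lemma delta1_smul: "delta1 a (smul p f) = smul p (delta1 a f)"
  by (simp add: fun_eq_iff smul_def delta1_def sum_distrib_left mult.left_commute)

lemma cochain1_diff: "f \<in> cochain1 a m \<Longrightarrow> g \<in> cochain1 a m \<Longrightarrow> f - g \<in> cochain1 a m"
  by (simp add: cochain1_iff)

lemma cochain1_smul: "f \<in> cochain1 a m \<Longrightarrow> smul p f \<in> cochain1 a m"
  by (simp add: cochain1_iff smul_def)

lemma cocycle_lifts:
  assumes d: "d \<in> cochain1 a m" "delta1 a d = 0"
  shows "\<exists>\<theta>\<in>D_X3 a m. \<forall>H. \<theta> (lform a H) = d H"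
proof -
  define \<theta> where "\<theta> = der (d H1) (d H2) (d H3)"
  have \<theta>: "\<theta> \<in> Der" by (simp add: \<theta>_def der_in_Der)
  have "delta1 a d Y = 0" for Y using d(2) by simp
  from this[of Y1] this[of Y2] this[of Y3]
  have "d H4 = d H1 - cS a * d H2" "d H5 = d H1 + d H3" "d H6 = d H2 + d H3"
    by (simp_all add: delta1_simps)
  then have vals: "\<theta> (lform a H) = d H" for H
    using Der_lform[OF \<theta>] by (cases H) (simp_all add: \<theta>_def)
  then have "\<theta> \<in> D_X3 a m" using \<theta> d(1) by (simp add: D_X3_iff cochain1_iff)
  with vals show ?thesis by blast
qed

lemma D_X3_evaluates:
  assumes "\<theta> \<in> D_X3 a m"
  shows "(\<lambda>H. \<theta> (lform a H)) \<in> cochain1 a m" "delta1 a (\<lambda>H. \<theta> (lform a H)) = 0"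
proof -
  show "(\<lambda>H. \<theta> (lform a H)) \<in> cochain1 a m" using assms by (simp add: D_X3_iff cochain1_iff)
  have "delta1 a (\<lambda>H. \<theta> (lform a H)) Y = 0" for Y
    using assms Der_lform[of \<theta>] by (cases Y) (simp_all add: delta1_simps D_X3_iff)
  then show "delta1 a (\<lambda>H. \<theta> (lform a H)) = 0" by (simp add: fun_eq_iff)
qed

text \<open>
  The homological core. If \<open>u\<^sub>i c\<close> is the image of \<open>s\<^sub>i\<close>, then \<open>u\<^sub>i s\<^sub>j - u\<^sub>j s\<^sub>i\<close> is a cocycle,
  that is, a multiderivation. By Koszul exactness the \<open>s\<^sub>i\<close> can be corrected by multiderivations until
  \<open>u\<^sub>1 s\<^sub>2 = u\<^sub>2 s\<^sub>1\<close>; then \<open>s\<^sub>1\<close> is divisible by \<open>u\<^sub>1\<close>, and the quotient is a preimage of \<open>c\<close>.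
\<close>

lemma regular_annihilator_imp_coboundary:
  assumes free: "free_submodule smul (D_X3 a m)" and reg: "regular_triple u1 u2 u3"
    and u1: "smul u1 c \<in> coboundaries a m" and u2: "smul u2 c \<in> coboundaries a m"
    and u3: "smul u3 c \<in> coboundaries a m"
  shows "c \<in> coboundaries a m"
proof -
  have preimage: "\<exists>s\<in>cochain1 a m. delta1 a s = g" if "g \<in> coboundaries a m" for g
    using that unfolding coboundaries_def by blast
  obtain s1 where s1: "s1 \<in> cochain1 a m" "delta1 a s1 = smul u1 c" using preimage[OF u1] by blast
  obtain s2 where s2: "s2 \<in> cochain1 a m" "delta1 a s2 = smul u2 c" using preimage[OF u2] by blast
  obtain s3 where s3: "s3 \<in> cochain1 a m" "delta1 a s3 = smul u3 c" using preimage[OF u3] by blast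
  have lift: "\<exists>\<theta>\<in>D_X3 a m. \<forall>H. \<theta> (lform a H) = u * s' H - u' * s H"
    if "s \<in> cochain1 a m" "s' \<in> cochain1 a m" "delta1 a s = smul u c" "delta1 a s' = smul u' c" for s s' u u'
  proof -
    have "smul u s' - smul u' s \<in> cochain1 a m" using that by (intro cochain1_diff cochain1_smul)
    moreover have "delta1 a (smul u s' - smul u' s) = 0"
      by (simp add: delta1_diff delta1_smul that) (simp add: smul_def fun_eq_iff)
    ultimately show ?thesis using cocycle_lifts[of "smul u s' - smul u' s" a m] by (simp add: smul_def)
  qed
  obtain \<theta>12 where \<theta>12: "\<theta>12 \<in> D_X3 a m" "\<forall>H. \<theta>12 (lform a H) = u1 * s2 H - u2 * s1 H"
    using lift[OF s1(1) s2(1) s1(2) s2(2)] by blast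
  obtain \<theta>13 where \<theta>13: "\<theta>13 \<in> D_X3 a m" "\<forall>H. \<theta>13 (lform a H) = u1 * s3 H - u3 * s1 H"
    using lift[OF s1(1) s3(1) s1(2) s3(2)] by blast
  obtain \<theta>23 where \<theta>23: "\<theta>23 \<in> D_X3 a m" "\<forall>H. \<theta>23 (lform a H) = u2 * s3 H - u3 * s2 H"
    using lift[OF s2(1) s3(1) s2(2) s3(2)] by blast
  have "smul u1 \<theta>23 - smul u2 \<theta>13 + smul u3 \<theta>12 \<in> D_X3 a m" (is "?\<theta> \<in> _")
    by (intro module.subspace_scale[OF module_smul subspace_D_X3] module.subspace_add[OF module_smul subspace_D_X3]
      module.subspace_diff[OF module_smul subspace_D_X3] \<theta>12 \<theta>13 \<theta>23)
  then have "?\<theta> \<in> Der" by (simp add: D_X3_iff)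
  moreover have van: "?\<theta> (lform a H) = 0" for H
    by (simp add: smul_def \<theta>12 \<theta>13 \<theta>23 algebra_simps)
  ultimately have "?\<theta> p = 0" for p
    using Der_eq_der[of ?\<theta> p] van[of H1] van[of H2] van[of H3] by (simp add: der_def)
  then have "?\<theta> = 0" by (simp add: fun_eq_iff)
  from koszul_exact_free[OF free reg \<theta>12(1) \<theta>13(1) \<theta>23(1) this]
  obtain \<epsilon>1 \<epsilon>2 \<epsilon>3 where \<epsilon>: "\<epsilon>1 \<in> D_X3 a m" "\<epsilon>2 \<in> D_X3 a m" and e12: "\<theta>12 = smul u1 \<epsilon>2 - smul u2 \<epsilon>1"
    by blast
  define e1 e2 where "e1 H = \<epsilon>1 (lform a H)" and "e2 H = \<epsilon>2 (lform a H)" for H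
  have e: "e1 \<in> cochain1 a m" "e2 \<in> cochain1 a m" "delta1 a e1 = 0"
    using D_X3_evaluates[OF \<epsilon>(1)] D_X3_evaluates[OF \<epsilon>(2)] unfolding e1_def[abs_def] e2_def[abs_def] by auto
  have "\<exists>t. lform a H ^ m H dvd t \<and> s1 H - e1 H = u1 * t" for H
  proof (rule koszul_quotient[OF reg])
    show "lform a H ^ m H \<noteq> 0" by (simp add: lform_neq_0)
    show "lform a H ^ m H dvd s1 H - e1 H" "lform a H ^ m H dvd s2 H - e2 H"
      using s1 s2 e by (simp_all add: cochain1_iff)
    have "u1 * s2 H - u2 * s1 H = u1 * e2 H - u2 * e1 H"
      using \<theta>12(2)[THEN spec, of H] unfolding e12 by (simp add: smul_def e1_def e2_def)
    then show "u1 * (s2 H - e2 H) = u2 * (s1 H - e1 H)" by algebra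
  qed
  then obtain t where t: "\<And>H. lform a H ^ m H dvd t H" "\<And>H. s1 H - e1 H = u1 * t H" by metis
  then have "t \<in> cochain1 a m" and "s1 - e1 = smul u1 t" by (simp_all add: cochain1_iff fun_eq_iff smul_def)
  moreover have "smul u1 (delta1 a t) = smul u1 c"
    using s1(2) e(3) by (simp add: calculation(2)[symmetric] delta1_diff flip: delta1_smul)
  then have "delta1 a t = c" using reg by (simp add: smul_def fun_eq_iff regular_triple_def)
  ultimately show ?thesis by (auto simp: coboundaries_def)
qed

lemma regular_triple_linear:
  assumes "prime_elem u" "prime_elem v" "\<not> u dvd v" "\<not> v dvd u" "regular_modulo p u v"
  shows "regular_triple (u ^ k) (v ^ l) p"
  unfolding regular_triple_def
proof (intro conjI allI impI)
  have nz: "\<not> u dvd v ^ l"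
    using assms(1,3) prime_elem_dvd_power by blast
  show "u ^ k \<noteq> 0" using assms(1) by (simp add: prime_elem_def)
  show "u ^ k dvd f" if "u ^ k dvd v ^ l * f" for f
    using prime_elem_power_cancel[OF assms(1) nz that] .
  show "regular_modulo p (u ^ k) (v ^ l)" by (rule regular_modulo_powers[OF assms])
qed

lemma regular_triple_lform:
  assumes "\<not> lform a H dvd lform a H'" "\<not> lform a H' dvd lform a H"
    and "\<exists>r s. xS - A = lform a H * r + lform a H' * s" "\<exists>r s. yS - B = lform a H * r + lform a H' * s"
      "\<exists>r s. zS - C = lform a H * r + lform a H' * s"
    and "endo A B C (lform a H) = 0" "endo A B C (lform a H') = 0" "endo A B C p \<noteq> 0"
  shows "regular_triple (lform a H ^ k) (lform a H' ^ l) p"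
  by (rule regular_triple_linear[OF prime_elem_lform prime_elem_lform assms(1,2)
    regular_modulo_linear[OF assms(3-8)]])

lemma coboundariesI:
  assumes "f \<in> cochain1 a m" "delta1 a f = c"
  shows "c \<in> coboundaries a m"
  using assms unfolding coboundaries_def by blast

definition planewise :: "'a::field_char_0 S \<Rightarrow> 'a S \<Rightarrow> 'a S \<Rightarrow> 'a S \<Rightarrow> 'a S \<Rightarrow> 'a S \<Rightarrow> plane \<Rightarrow> 'a S"
  where "planewise f1 f2 f3 f4 f5 f6 H =
    (case H of H1 \<Rightarrow> f1 | H2 \<Rightarrow> f2 | H3 \<Rightarrow> f3 | H4 \<Rightarrow> f4 | H5 \<Rightarrow> f5 | H6 \<Rightarrow> f6)"

definition triplewise :: "'a::field_char_0 S \<Rightarrow> 'a S \<Rightarrow> 'a S \<Rightarrow> triple_point \<Rightarrow> 'a S"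
  where "triplewise g1 g2 g3 Y = (case Y of Y1 \<Rightarrow> g1 | Y2 \<Rightarrow> g2 | Y3 \<Rightarrow> g3)"

lemma delta1_planewise: "delta1 a (planewise f1 f2 f3 f4 f5 f6) =
    triplewise (f1 - cS a * f2 - f4) (f1 + f3 - f5) (f2 + f3 - f6)"
proof
  fix Y show "delta1 a (planewise f1 f2 f3 f4 f5 f6) Y =
    triplewise (f1 - cS a * f2 - f4) (f1 + f3 - f5) (f2 + f3 - f6) Y"
    by (cases Y) (simp_all add: delta1_simps planewise_def triplewise_def)
qed

lemma triplewise_simps:
  "smul p (triplewise g1 g2 g3) = triplewise (p * g1) (p * g2) (p * g3)"
  "triplewise g1 g2 g3 + triplewise h1 h2 h3 = triplewise (g1 + h1) (g2 + h2) (g3 + h3)"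
  "triplewise g1 g2 g3 - triplewise h1 h2 h3 = triplewise (g1 - h1) (g2 - h2) (g3 - h3)"
  by (auto simp: fun_eq_iff smul_def triplewise_def split: triple_point.splits)

lemma planewise_cochain1:
  "planewise f1 f2 f3 f4 f5 f6 \<in> cochain1 a m \<longleftrightarrow>
    xS ^ m H1 dvd f1 \<and> yS ^ m H2 dvd f2 \<and> zS ^ m H3 dvd f3 \<and> (xS - cS a * yS) ^ m H4 dvd f4 \<and>
    (xS + zS) ^ m H5 dvd f5 \<and> (yS + zS) ^ m H6 dvd f6"
  by (simp add: cochain1_iff all_plane planewise_def)

text \<open>
  For exhibiting a coboundary by naming a preimage: \<open>f\<^sub>i\<close> is its entry at \<open>H\<^sub>i\<close>.
\<close>

lemma planewise_coboundary:
  assumes "xS ^ m H1 dvd f1" "yS ^ m H2 dvd f2" "zS ^ m H3 dvd f3" "(xS - cS a * yS) ^ m H4 dvd f4"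
    "(xS + zS) ^ m H5 dvd f5" "(yS + zS) ^ m H6 dvd f6"
    and "g1 = f1 - cS a * f2 - f4" "g2 = f1 + f3 - f5" "g3 = f2 + f3 - f6"
  shows "triplewise g1 g2 g3 \<in> coboundaries a m"
  using assms by (intro coboundariesI[of "planewise f1 f2 f3 f4 f5 f6"])
    (auto simp: planewise_cochain1 delta1_planewise)

text \<open>
  A generator such as \<open>x\<^bsup>m\<^sub>1\<^esup>\<close> at \<open>Y\<^sub>1\<close> is killed by \<open>\<alpha>\<^sub>4\<^bsup>m\<^sub>4\<^esup>\<close>, because the entry at \<open>H\<^sub>4\<close>
  can be changed alone; by \<open>\<alpha>\<^sub>5\<^bsup>m\<^sub>5\<^esup>\<close>, because the entry at \<open>H\<^sub>1\<close> can be compensated at \<open>Y\<^sub>2\<close> by that at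
  \<open>H\<^sub>5\<close>; and by \<open>z\<^bsup>m\<^sub>3\<^esup> \<alpha>\<^sub>6\<^bsup>m\<^sub>6\<^esup>\<close>, because it can also be compensated at \<open>Y\<^sub>2\<close> by the entry at \<open>H\<^sub>3\<close>
  and then at \<open>Y\<^sub>3\<close> by that at \<open>H\<^sub>6\<close>. On the line \<open>H\<^sub>4 \<inter> H\<^sub>5\<close>, spanned by \<open>(\<alpha>, 1, -\<alpha>)\<close>, the last
  product does not vanish since \<open>\<alpha> \<noteq> 0, 1\<close>. The other two generators are treated in the same way,
  with the lines \<open>H\<^sub>4 \<inter> H\<^sub>6\<close> and \<open>H\<^sub>5 \<inter> H\<^sub>6\<close>.
\<close>

lemma generators_are_coboundaries:
  fixes a :: "'a::field_char_0"
  assumes a: "a \<noteq> 0" "a \<noteq> 1" and m: "\<forall>H. m H > 0" and free: "free_submodule smul (D_X3 a m)"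
  shows "triplewise (xS ^ m H1) 0 0 \<in> coboundaries a m"
    and "triplewise (yS ^ m H2) 0 0 \<in> coboundaries a m"
    and "triplewise 0 (zS ^ m H3) 0 \<in> coboundaries a m"
proof -
  show "triplewise (xS ^ m H1) 0 0 \<in> coboundaries a m"
  proof (rule regular_annihilator_imp_coboundary[OF free])
    show "regular_triple (lform a H4 ^ m H4) (lform a H5 ^ m H5) (zS ^ m H3 * (yS + zS) ^ m H6)"
    proof (rule regular_triple_lform[of a H4 H5 "cS a * yS" yS "- cS a * yS"])
      show "\<not> lform a H4 dvd lform a H5"
        unfolding lform_dvd_iff by (rule nonzero_by_evaluation[of _ "(0, 0, 1)"]) simp
      show "\<not> lform a H5 dvd lform a H4"
        unfolding lform_dvd_iff by (rule nonzero_by_evaluation[of _ "(1, 0, 0)"]) simp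
      show "\<exists>r s. xS - cS a * yS = lform a H4 * r + lform a H5 * s"
        by (rule exI[of _ 1], rule exI[of _ 0]) simp
      show "\<exists>r s. yS - yS = lform a H4 * r + lform a H5 * s"
        by (rule exI[of _ 0], rule exI[of _ 0]) simp
      show "\<exists>r s. zS - - cS a * yS = lform a H4 * r + lform a H5 * s"
        by (rule exI[of _ "- 1"], rule exI[of _ 1]) simp
      show "endo (cS a * yS) yS (- cS a * yS) (zS ^ m H3 * (yS + zS) ^ m H6) \<noteq> 0"
        using a by (intro nonzero_by_evaluation[of _ "(1, 1, 1)"]) simp
    qed simp_all
    show "smul (lform a H4 ^ m H4) (triplewise (xS ^ m H1) 0 0) \<in> coboundaries a m"
      unfolding triplewise_simps
      by (rule planewise_coboundary[of m 0 0 0 a "- (lform a H4 ^ m H4 * xS ^ m H1)" 0 0]) simp_all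
    show "smul (lform a H5 ^ m H5) (triplewise (xS ^ m H1) 0 0) \<in> coboundaries a m"
      unfolding triplewise_simps
      by (rule planewise_coboundary[of m "lform a H5 ^ m H5 * xS ^ m H1" 0 0 a 0 "lform a H5 ^ m H5 * xS ^ m H1" 0]) simp_all
    let ?f = "zS ^ m H3 * (yS + zS) ^ m H6 * xS ^ m H1"
    show "smul (zS ^ m H3 * (yS + zS) ^ m H6) (triplewise (xS ^ m H1) 0 0) \<in> coboundaries a m"
      unfolding triplewise_simps
      by (rule planewise_coboundary[of m ?f 0 "- ?f" a 0 0 "- ?f"]) simp_all
  qed
  show "triplewise (yS ^ m H2) 0 0 \<in> coboundaries a m"
  proof (rule regular_annihilator_imp_coboundary[OF free])
    show "regular_triple (lform a H4 ^ m H4) (lform a H6 ^ m H6) (zS ^ m H3 * (xS + zS) ^ m H5)"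
    proof (rule regular_triple_lform[of a H4 H6 "cS a * yS" yS "- yS"])
      show "\<not> lform a H4 dvd lform a H6"
        unfolding lform_dvd_iff by (rule nonzero_by_evaluation[of _ "(0, 0, 1)"]) simp
      show "\<not> lform a H6 dvd lform a H4"
        unfolding lform_dvd_iff by (rule nonzero_by_evaluation[of _ "(1, 0, 0)"]) simp
      show "\<exists>r s. xS - cS a * yS = lform a H4 * r + lform a H6 * s"
        by (rule exI[of _ 1], rule exI[of _ 0]) simp
      show "\<exists>r s. yS - yS = lform a H4 * r + lform a H6 * s"
        by (rule exI[of _ 0], rule exI[of _ 0]) simp
      show "\<exists>r s. zS - - yS = lform a H4 * r + lform a H6 * s"
        by (rule exI[of _ 0], rule exI[of _ 1]) simp
      show "endo (cS a * yS) yS (- yS) (zS ^ m H3 * (xS + zS) ^ m H5) \<noteq> 0"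
        using a by (intro nonzero_by_evaluation[of _ "(1, 1, 1)"]) simp
    qed simp_all
    have a1: "cS a * (cS (1 / a) * p) = p" for p
      using a by (simp flip: mult.assoc cS_mult)
    show "smul (lform a H4 ^ m H4) (triplewise (yS ^ m H2) 0 0) \<in> coboundaries a m"
      unfolding triplewise_simps
      by (rule planewise_coboundary[of m 0 0 0 a "- (lform a H4 ^ m H4 * yS ^ m H2)" 0 0]) simp_all
    let ?f = "- (cS (1 / a) * (lform a H6 ^ m H6 * yS ^ m H2))"
    show "smul (lform a H6 ^ m H6) (triplewise (yS ^ m H2) 0 0) \<in> coboundaries a m"
      unfolding triplewise_simps
      by (rule planewise_coboundary[of m 0 ?f 0 a 0 0 ?f]) (simp_all add: a1)
    let ?f = "cS (1 / a) * (zS ^ m H3 * (xS + zS) ^ m H5 * yS ^ m H2)"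
    show "smul (zS ^ m H3 * (xS + zS) ^ m H5) (triplewise (yS ^ m H2) 0 0) \<in> coboundaries a m"
      unfolding triplewise_simps
      by (rule planewise_coboundary[of m 0 "- ?f" ?f a 0 ?f 0]) (simp_all add: a1)
  qed
  show "triplewise 0 (zS ^ m H3) 0 \<in> coboundaries a m"
  proof (rule regular_annihilator_imp_coboundary[OF free])
    show "regular_triple (lform a H5 ^ m H5) (lform a H6 ^ m H6) (xS ^ m H1 * (xS - cS a * yS) ^ m H4)"
    proof (rule regular_triple_lform[of a H5 H6 xS xS "- xS"])
      show "\<not> lform a H5 dvd lform a H6"
        unfolding lform_dvd_iff by (rule nonzero_by_evaluation[of _ "(0, 1, 0)"]) simp
      show "\<not> lform a H6 dvd lform a H5"
        unfolding lform_dvd_iff by (rule nonzero_by_evaluation[of _ "(1, 0, 0)"]) simp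
      show "\<exists>r s. xS - xS = lform a H5 * r + lform a H6 * s"
        by (rule exI[of _ 0], rule exI[of _ 0]) simp
      show "\<exists>r s. yS - xS = lform a H5 * r + lform a H6 * s"
        by (rule exI[of _ "- 1"], rule exI[of _ 1]) simp
      show "\<exists>r s. zS - - xS = lform a H5 * r + lform a H6 * s"
        by (rule exI[of _ 1], rule exI[of _ 0]) simp
      show "endo xS xS (- xS) (xS ^ m H1 * (xS - cS a * yS) ^ m H4) \<noteq> 0"
        using a by (intro nonzero_by_evaluation[of _ "(1, 1, 1)"]) simp
    qed simp_all
    show "smul (lform a H5 ^ m H5) (triplewise 0 (zS ^ m H3) 0) \<in> coboundaries a m"
      unfolding triplewise_simps
      by (rule planewise_coboundary[of m 0 0 0 a 0 "- (lform a H5 ^ m H5 * zS ^ m H3)" 0]) simp_all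
    let ?f = "lform a H6 ^ m H6 * zS ^ m H3"
    show "smul (lform a H6 ^ m H6) (triplewise 0 (zS ^ m H3) 0) \<in> coboundaries a m"
      unfolding triplewise_simps
      by (rule planewise_coboundary[of m 0 0 ?f a 0 0 ?f]) simp_all
    let ?f = "xS ^ m H1 * (xS - cS a * yS) ^ m H4 * zS ^ m H3"
    show "smul (xS ^ m H1 * (xS - cS a * yS) ^ m H4) (triplewise 0 (zS ^ m H3) 0) \<in> coboundaries a m"
      unfolding triplewise_simps
      by (rule planewise_coboundary[of m ?f 0 0 a ?f 0 0]) simp_all
  qed
qed

lemma free_imp_cohomology2_trivial:
  fixes a :: "'a::field_char_0"
  assumes a: "a \<noteq> 0" "a \<noteq> 1" and m: "\<forall>H. m H > 0" and free: "free_submodule smul (D_X3 a m)"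
  shows "cochain2 a m \<subseteq> coboundaries a m"
proof
  fix g assume g: "g \<in> cochain2 a m"
  note gens = generators_are_coboundaries[OF assms]
  have scaled: "triplewise (p * g1) (p * g2) (p * g3) \<in> coboundaries a m"
    if "triplewise g1 g2 g3 \<in> coboundaries a m" for p g1 g2 g3
    using coboundaries_smul[OF that, of p] by (simp add: triplewise_simps)
  note add = coboundaries_add[of "triplewise _ _ _" _ _ "triplewise _ _ _", unfolded triplewise_simps]
  note diff = coboundaries_diff[of "triplewise _ _ _" _ _ "triplewise _ _ _", unfolded triplewise_simps]
  have x: "triplewise (xS ^ m H1) (xS ^ m H1) 0 \<in> coboundaries a m"
    by (rule planewise_coboundary[of m "xS ^ m H1" 0 0 a 0 0 0]) simp_all
  have y: "triplewise (- cS a * yS ^ m H2) 0 (yS ^ m H2) \<in> coboundaries a m"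
    by (rule planewise_coboundary[of m 0 "yS ^ m H2" 0 a 0 0 0]) simp_all
  have z: "triplewise 0 (zS ^ m H3) (zS ^ m H3) \<in> coboundaries a m"
    by (rule planewise_coboundary[of m 0 0 "zS ^ m H3" a 0 0 0]) simp_all
  have l4: "triplewise ((xS - cS a * yS) ^ m H4) 0 0 \<in> coboundaries a m"
    by (rule planewise_coboundary[of m 0 0 0 a "- ((xS - cS a * yS) ^ m H4)" 0 0]) simp_all
  have l5: "triplewise 0 ((xS + zS) ^ m H5) 0 \<in> coboundaries a m"
    by (rule planewise_coboundary[of m 0 0 0 a 0 "- ((xS + zS) ^ m H5)" 0]) simp_all
  have l6: "triplewise 0 0 ((yS + zS) ^ m H6) \<in> coboundaries a m"
    by (rule planewise_coboundary[of m 0 0 0 a 0 0 "- ((yS + zS) ^ m H6)"]) simp_all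
  have x2: "triplewise 0 (xS ^ m H1) 0 \<in> coboundaries a m"
    using diff[OF x gens(1)] by simp
  have y3: "triplewise 0 0 (yS ^ m H2) \<in> coboundaries a m"
    using add[OF y scaled[OF gens(2), of "cS a"]] by simp
  have z3: "triplewise 0 0 (zS ^ m H3) \<in> coboundaries a m"
    using diff[OF z gens(3)] by simp
  have "\<forall>Y. g Y \<in> J_triple a m Y" using g by (simp add: cochain2_def)
  then obtain r1 s1 t1 r2 s2 t2 r3 s3 t3 where
    g1: "g Y1 = xS ^ m H1 * r1 + yS ^ m H2 * s1 + (xS - cS a * yS) ^ m H4 * t1" and
    g2: "g Y2 = xS ^ m H1 * r2 + zS ^ m H3 * s2 + (xS + zS) ^ m H5 * t2" and
    g3: "g Y3 = yS ^ m H2 * r3 + zS ^ m H3 * s3 + (yS + zS) ^ m H6 * t3"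
    unfolding all_triple_point J_triple_iff[OF a(1)] by blast
  have "triplewise (g Y1) 0 0 \<in> coboundaries a m"
    using add[OF add[OF scaled[OF gens(1), of r1] scaled[OF gens(2), of s1]] scaled[OF l4, of t1]]
    unfolding g1 by (simp only: mult.commute[of r1] mult.commute[of s1] mult.commute[of t1] mult_zero_right add_0_left add_0_right)
  moreover have "triplewise 0 (g Y2) 0 \<in> coboundaries a m"
    using add[OF add[OF scaled[OF x2, of r2] scaled[OF gens(3), of s2]] scaled[OF l5, of t2]]
    unfolding g2 by (simp only: mult.commute[of r2] mult.commute[of s2] mult.commute[of t2] mult_zero_right add_0_left add_0_right)
  moreover have "triplewise 0 0 (g Y3) \<in> coboundaries a m"
    using add[OF add[OF scaled[OF y3, of r3] scaled[OF z3, of s3]] scaled[OF l6, of t3]]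
    unfolding g3 by (simp only: mult.commute[of r3] mult.commute[of s3] mult.commute[of t3] mult_zero_right add_0_left add_0_right)
  ultimately have "triplewise (g Y1) (g Y2) (g Y3) \<in> coboundaries a m"
    using add[OF add] by (metis add_0_left add_0_right)
  moreover have "triplewise (g Y1) (g Y2) (g Y3) = g"
    by (auto simp: fun_eq_iff triplewise_def split: triple_point.splits)
  ultimately show "g \<in> coboundaries a m" by simp
qed

section \<open>Vanishing cohomology makes the module of multiderivations free\<close>

lemma free_submoduleI:
  fixes M :: "('b \<Rightarrow> 'a::field_char_0 S) set"
  assumes J: "finite J" and M: "module.subspace smul M" and \<theta>: "\<And>j. j \<in> J \<Longrightarrow> \<theta> j \<in> M"
    and indep: "\<And>t. (\<Sum>j\<in>J. smul (t j) (\<theta> j)) = 0 \<Longrightarrow> \<forall>j\<in>J. t j = 0"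
    and gen: "\<And>x. x \<in> M \<Longrightarrow> \<exists>t. x = (\<Sum>j\<in>J. smul (t j) (\<theta> j))"
  shows "free_submodule smul M"
proof -
  interpret module "smul :: 'a S \<Rightarrow> ('b \<Rightarrow> 'a S) \<Rightarrow> _" by (rule module_smul)
  have inj: "inj_on \<theta> J"
  proof (rule inj_onI, rule ccontr)
    fix i j assume ij: "i \<in> J" "j \<in> J" "\<theta> i = \<theta> j" "i \<noteq> j"
    define t :: "'c \<Rightarrow> 'a S" where "t k = (if k = i then 1 else if k = j then - 1 else 0)" for k
    have "(\<Sum>k\<in>J. smul (t k) (\<theta> k)) = (\<Sum>k\<in>{i, j}. smul (t k) (\<theta> k))"
      using J ij by (intro sum.mono_neutral_right) (auto simp: t_def)
    also have "\<dots> = 0" using ij by (simp add: t_def)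
    finally show False using indep[of t] ij by (auto simp: t_def)
  qed
  have "independent (\<theta> ` J)"
  proof
    assume "dependent (\<theta> ` J)"
    then obtain u where u: "\<exists>v\<in>\<theta> ` J. u v \<noteq> 0" "(\<Sum>v\<in>\<theta> ` J. smul (u v) v) = 0"
      using J by (auto simp: dependent_finite)
    then have "(\<Sum>j\<in>J. smul (u (\<theta> j)) (\<theta> j)) = 0"
      by (simp add: sum.reindex[OF inj])
    from indep[OF this] u(1) show False by auto
  qed
  moreover have "span (\<theta> ` J) = M"
  proof
    show "span (\<theta> ` J) \<subseteq> M" using M \<theta> by (intro span_minimal) auto
    show "M \<subseteq> span (\<theta> ` J)"
    proof
      fix x assume "x \<in> M"
      then obtain t where "x = (\<Sum>j\<in>J. smul (t j) (\<theta> j))" using gen by blast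
      then show "x \<in> span (\<theta> ` J)" by (auto intro!: span_sum intro: span_scale span_base)
    qed
  qed
  ultimately show ?thesis unfolding free_submodule_def by blast
qed

text \<open>
  The condition at one triple point on the values of a derivation on two of the three forms through
  it; the value on the third form is then determined.
\<close>

fun syzygy :: "'a::field_char_0 \<Rightarrow> (plane \<Rightarrow> nat) \<Rightarrow> triple_point \<Rightarrow> 'a S \<Rightarrow> 'a S \<Rightarrow> bool"
  where
    "syzygy a m Y1 f g \<longleftrightarrow> xS ^ m H1 dvd f \<and> yS ^ m H2 dvd g \<and> (xS - cS a * yS) ^ m H4 dvd f - cS a * g"
  | "syzygy a m Y2 f g \<longleftrightarrow> xS ^ m H1 dvd f \<and> zS ^ m H3 dvd g \<and> (xS + zS) ^ m H5 dvd f + g"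
  | "syzygy a m Y3 f g \<longleftrightarrow> yS ^ m H2 dvd f \<and> zS ^ m H3 dvd g \<and> (yS + zS) ^ m H6 dvd f + g"

lemma syzygy_basis:
  fixes a :: "'a::field_char_0"
  shows "\<exists>p q w. homog_basis (syzygy a m Y) p q w"
proof (cases Y)
  case Y1
  interpret pencil xS yS 0 yS "lform a H4" a 1 0
    by unfold_locales (simp_all only: prime_elem_lform homog_lform homog_gens, simp_all)
  show ?thesis
    using homog_basis_exists[of xS yS "m H1" "m H2" "m H4" a] unfolding Y1 syzygy.simps[abs_def]
    by (simp add: form_def homog_gens)
next
  case Y2
  interpret pencil xS 0 zS xS "lform a H5" 1 0 "- 1"
    by unfold_locales (simp_all only: prime_elem_lform homog_lform homog_gens, simp_all add: cS_minus add.commute)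
  show ?thesis
    using homog_basis_exists[of xS zS "m H1" "m H3" "m H5" "- 1"] unfolding Y2 syzygy.simps[abs_def]
    by (simp add: form_def homog_gens cS_minus)
next
  case Y3
  interpret pencil 0 yS zS yS "lform a H6" 0 1 "- 1"
    by unfold_locales (simp_all only: prime_elem_lform homog_lform homog_gens, simp_all add: cS_minus add.commute)
  show ?thesis
    using homog_basis_exists[of yS zS "m H2" "m H3" "m H6" "- 1"] unfolding Y3 syzygy.simps[abs_def]
    by (simp add: form_def homog_gens cS_minus)
qed

lemma D_X3_iff_syzygies:
  "\<theta> \<in> D_X3 a m \<longleftrightarrow> \<theta> \<in> Der \<and> syzygy a m Y1 (\<theta> xS) (\<theta> yS) \<and> syzygy a m Y2 (\<theta> xS) (\<theta> zS) \<and>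
    syzygy a m Y3 (\<theta> yS) (\<theta> zS)"
  by (cases "\<theta> \<in> Der") (simp_all only: D_X3_iff all_plane Der_lform lform.simps syzygy.simps, blast+)

text \<open>
  Surjectivity of \<open>\<delta>\<^sup>1\<close> in terms of syzygies: the discrepancies of three independently chosen
  syzygies along \<open>H\<^sub>1\<close>, \<open>H\<^sub>2\<close>, \<open>H\<^sub>3\<close> can be prescribed. Apply surjectivity to the cochain that carries each
  prescribed discrepancy at one of the two triple points on that plane.
\<close>

lemma syzygies_lift:
  fixes a :: "'a::field_char_0"
  assumes a: "a \<noteq> 0" and triv: "cochain2 a m \<subseteq> coboundaries a m"
  shows "\<exists>f1 g1 f2 g2 f3 g3. syzygy a m Y1 f1 g1 \<and> syzygy a m Y2 f2 g2 \<and> syzygy a m Y3 f3 g3 \<and>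
    f1 - f2 = xS ^ m H1 * c1 \<and> g1 - f3 = yS ^ m H2 * c2 \<and> g2 - g3 = zS ^ m H3 * c3"
proof -
  have "triplewise (- (xS ^ m H1 * c1)) (- (zS ^ m H3 * c3)) (yS ^ m H2 * c2) \<in> cochain2 a m" (is "?g \<in> _")
  proof -
    have "?g Y1 \<in> J_triple a m Y1" unfolding J_triple_iff[OF a] triplewise_def
      by (rule exI[of _ "- c1"], rule exI[of _ 0], rule exI[of _ 0]) simp
    moreover have "?g Y2 \<in> J_triple a m Y2" unfolding J_triple_iff[OF a] triplewise_def
      by (rule exI[of _ 0], rule exI[of _ "- c3"], rule exI[of _ 0]) simp
    moreover have "?g Y3 \<in> J_triple a m Y3" unfolding J_triple_iff[OF a] triplewise_def
      by (rule exI[of _ c2], rule exI[of _ 0], rule exI[of _ 0]) simp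
    ultimately show ?thesis unfolding cochain2_def by (simp add: all_triple_point)
  qed
  from subsetD[OF triv this] obtain F where eq': "?g = delta1 a F" and F: "F \<in> cochain1 a m"
    unfolding coboundaries_def by (rule imageE)
  note eq = eq'[symmetric]
  from F have d: "xS ^ m H1 dvd F H1" "yS ^ m H2 dvd F H2" "zS ^ m H3 dvd F H3"
    "(xS - cS a * yS) ^ m H4 dvd F H4" "(xS + zS) ^ m H5 dvd F H5" "(yS + zS) ^ m H6 dvd F H6"
    unfolding cochain1_iff all_plane lform.simps by blast+
  have h: "F H1 - cS a * F H2 - F H4 = - (xS ^ m H1 * c1)" "F H1 + F H3 - F H5 = - (zS ^ m H3 * c3)"
    "F H2 + F H3 - F H6 = yS ^ m H2 * c2"
    using fun_cong[OF eq, of Y1] fun_cong[OF eq, of Y2] fun_cong[OF eq, of Y3]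
    by (simp_all only: delta1_simps triplewise_def triple_point.case)
  have minus: "p - q = - u \<Longrightarrow> p + u = q" and plus: "p - q = u \<Longrightarrow> p - u = q" for p q u :: "'a S"
    by (algebra, auto)
  have e: "(F H1 + xS ^ m H1 * c1) - cS a * F H2 = F H4" "F H1 + (F H3 + zS ^ m H3 * c3) = F H5"
    "(F H2 - yS ^ m H2 * c2) + F H3 = F H6"
    using minus[OF h(1)] minus[OF h(2)] plus[OF h(3)] by (simp_all only: diff_add_eq add.assoc)
  have *: "syzygy a m Y1 (F H1 + xS ^ m H1 * c1) (F H2)" "syzygy a m Y2 (F H1) (F H3 + zS ^ m H3 * c3)"
    "syzygy a m Y3 (F H2 - yS ^ m H2 * c2) (F H3)"
    unfolding syzygy.simps e using d by simp_all
  show ?thesis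
    by (rule exI, rule exI, rule exI, rule exI, rule exI, rule exI, intro conjI, rule *(1), rule *(2), rule *(3)) simp_all
qed
lemma UNIV_triple_point_bool:
  "(UNIV :: (triple_point \<times> bool) set) =
    {(Y1, True), (Y1, False), (Y2, True), (Y2, False), (Y3, True), (Y3, False)}"
  by (subst UNIV_Times_UNIV[symmetric]) (auto simp: UNIV_triple_point UNIV_bool)

lemma finite_triple_point_bool: "finite (UNIV :: (triple_point \<times> bool) set)"
  by (simp add: UNIV_triple_point_bool)

text \<open>
  The component (given by \<open>p\<close>) of the syzygy at \<open>Y\<close> with coordinates \<open>s\<close>. Six coordinates, two at each
  triple point, describe a choice of three syzygies.
\<close>

definition combine :: "(triple_point \<Rightarrow> bool \<Rightarrow> 'a::field_char_0 S) \<Rightarrow> triple_point \<Rightarrow> (triple_point \<times> bool \<Rightarrow> 'a S) \<Rightarrow> 'a S"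
  where "combine p Y s = s (Y, True) * p Y True + s (Y, False) * p Y False"

lemma combine_sum:
  "combine p Y (\<lambda>i. \<Sum>j\<in>J. t j * v j i) = (\<Sum>j\<in>J. t j * combine p Y (v j))"
  by (simp add: combine_def sum_distrib_right sum.distrib[symmetric] distrib_left mult.assoc)

text \<open>
  The \<open>3 \<times> 6\<close> matrix of discrepancies along \<open>H\<^sub>1\<close>, \<open>H\<^sub>2\<close>, \<open>H\<^sub>3\<close>. The rows are indexed by \<open>Y1\<close>,
  \<open>Y2\<close>, \<open>Y3\<close> merely as a three-element type: these stand for the planes, not for the triple points.
\<close>

fun gluing :: "(triple_point \<Rightarrow> bool \<Rightarrow> 'a::field_char_0 S) \<Rightarrow> (triple_point \<Rightarrow> bool \<Rightarrow> 'a S) \<Rightarrow>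
    triple_point \<Rightarrow> triple_point \<times> bool \<Rightarrow> 'a S"
  where
    "gluing p q Y1 (Y, b) = (case Y of Y1 \<Rightarrow> p Y1 b | Y2 \<Rightarrow> - p Y2 b | Y3 \<Rightarrow> 0)"
  | "gluing p q Y2 (Y, b) = (case Y of Y1 \<Rightarrow> q Y1 b | Y2 \<Rightarrow> 0 | Y3 \<Rightarrow> - p Y3 b)"
  | "gluing p q Y3 (Y, b) = (case Y of Y1 \<Rightarrow> 0 | Y2 \<Rightarrow> q Y2 b | Y3 \<Rightarrow> - q Y3 b)"

lemma gluing_sum:
  "(\<Sum>i\<in>UNIV. gluing p q Y1 i * s i) = combine p Y1 s - combine p Y2 s"
  "(\<Sum>i\<in>UNIV. gluing p q Y2 i * s i) = combine q Y1 s - combine p Y3 s"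
  "(\<Sum>i\<in>UNIV. gluing p q Y3 i * s i) = combine q Y2 s - combine q Y3 s"
  by (simp_all add: UNIV_triple_point_bool combine_def mult.commute)

lemma sum_smul_apply: "(\<Sum>j\<in>J. smul (t j) (\<theta> j)) x = (\<Sum>j\<in>J. t j * \<theta> j x)"
  by (induction J rule: infinite_finite_induct) (simp_all add: smul_def)

text \<open>
  Along \<open>H\<^sub>1\<close> every discrepancy is divisible by \<open>x\<^bsup>m\<^sub>1\<^esup>\<close>, and similarly along \<open>H\<^sub>2\<close> and \<open>H\<^sub>3\<close>. Only after
  division by these powers is the gluing matrix onto, so that \<open>homogeneous_kernel\<close> applies;
  the basis derivations correspond to the unit vectors in the free coordinates \<open>J\<close>.
\<close>

lemma cohomology2_trivial_imp_free:
  fixes a :: "'a::field_char_0"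
  assumes a: "a \<noteq> 0" and triv: "cochain2 a m \<subseteq> coboundaries a m"
  shows "free_submodule smul (D_X3 a m)"
proof -
  obtain p q w where basis: "\<And>Y. homog_basis (syzygy a m Y) (p Y) (q Y) (w Y)"
    using syzygy_basis[of a m] by metis
  have syz_iff: "syzygy a m Y f g \<longleftrightarrow> (\<exists>s t. f = s * p Y True + t * p Y False \<and> g = s * q Y True + t * q Y False)"
    for Y f g using basis[of Y] unfolding homog_basis_def by blast
  have syz_combine: "syzygy a m Y (combine p Y s) (combine q Y s)" for Y s
    unfolding syz_iff combine_def by blast
  have coordinates: "\<exists>s. \<forall>Y. combine p Y s = f Y \<and> combine q Y s = g Y"
    if fg: "\<And>Y. syzygy a m Y (f Y) (g Y)" for f g
  proof -
    have "\<exists>c. f Y = c True * p Y True + c False * p Y False \<and> g Y = c True * q Y True + c False * q Y False" for Y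
    proof -
      obtain s t where "f Y = s * p Y True + t * p Y False" "g Y = s * q Y True + t * q Y False"
        using fg[of Y] unfolding syz_iff by blast
      then show ?thesis by (intro exI[of _ "\<lambda>b. if b then s else t"]) simp
    qed
    then obtain c where "\<And>Y. f Y = c Y True * p Y True + c Y False * p Y False \<and>
        g Y = c Y True * q Y True + c Y False * q Y False"
      by metis
    then show ?thesis by (intro exI[of _ "\<lambda>(Y, b). c Y b"]) (simp add: combine_def)
  qed

  define k where "k r = (case r of Y1 \<Rightarrow> m H1 | Y2 \<Rightarrow> m H2 | Y3 \<Rightarrow> m H3)" for r
  define E :: "triple_point \<Rightarrow> 'a S" where "E r = (case r of Y1 \<Rightarrow> xS | Y2 \<Rightarrow> yS | Y3 \<Rightarrow> zS) ^ k r" for r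
  have E: "E r \<noteq> 0" "homog (2 ^ k r) (E r)" for r
    unfolding E_def by (cases r; simp add: homog_power homog_gens)+
  have syz_basis: "syzygy a m Y (p Y b) (q Y b)" for Y b
    using syz_combine[of Y "\<lambda>(Y', b'). if b' = b then 1 else 0"] by (cases b) (simp_all add: combine_def)
  have "E r dvd gluing p q r i" for r i
  proof (cases i)
    case (Pair Y b)
    then show ?thesis using syz_basis[of Y b] by (cases r; cases Y) (simp_all add: E_def k_def)
  qed
  then have "\<exists>A. gluing p q r i = E r * A" for r i by (meson dvdE)
  then obtain A where A: "\<And>r i. gluing p q r i = E r * A r i" by metis
  have rows: "E r * (\<Sum>i\<in>UNIV. A r i * s i) = (\<Sum>i\<in>UNIV. gluing p q r i * s i)" for r s
    by (simp add: A sum_distrib_left mult.assoc)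
  define W where "W i = w (fst i) (snd i)" for i
  have W: "W i \<noteq> 0" and homog_pq: "homog (W i) (p (fst i) (snd i))" "homog (W i) (q (fst i) (snd i))" for i
    using basis unfolding W_def homog_basis_def by blast+
  have "homog (W i) (gluing p q r i)" for r i
  proof (cases i)
    case (Pair Y b)
    then show ?thesis using homog_pq[of i] by (cases r; cases Y) (simp_all add: homog_minus homog_0)
  qed
  then have "homog (W i / 2 ^ k r) (A r i)" for r i
    using homog_cancel[OF E(2) _ E(1)] unfolding A by simp
  then have homog_A: "homog (1 / 2 ^ k r * W i) (A r i)" for r i by simp

  \<comment> \<open>surjectivity of \<open>\<delta>\<^sup>1\<close> enters here\<close>
  have onto: "\<exists>s. \<forall>r\<in>UNIV. (\<Sum>i\<in>UNIV. A r i * s i) = c r" for c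
  proof -
    obtain f1 g1 f2 g2 f3 g3 where syz: "syzygy a m Y1 f1 g1" "syzygy a m Y2 f2 g2" "syzygy a m Y3 f3 g3"
      and diff: "f1 - f2 = xS ^ m H1 * c Y1" "g1 - f3 = yS ^ m H2 * c Y2" "g2 - g3 = zS ^ m H3 * c Y3"
      using syzygies_lift[OF a triv] by metis
    have "\<exists>s. \<forall>Y. combine p Y s = triplewise f1 f2 f3 Y \<and> combine q Y s = triplewise g1 g2 g3 Y"
    proof (rule coordinates)
      show "syzygy a m Y (triplewise f1 f2 f3 Y) (triplewise g1 g2 g3 Y)" for Y
        using syz by (cases Y) (simp_all add: triplewise_def)
    qed
    then obtain s where s: "\<And>Y. combine p Y s = triplewise f1 f2 f3 Y" "\<And>Y. combine q Y s = triplewise g1 g2 g3 Y"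
      by blast
    have "E r * (\<Sum>i\<in>UNIV. A r i * s i) = E r * c r" for r
      unfolding rows by (cases r) (simp_all only: gluing_sum s triplewise_def triple_point.case diff E_def k_def)
    then have "(\<Sum>i\<in>UNIV. A r i * s i) = c r" for r
      using E(1)[of r] mult_left_cancel by blast
    then show ?thesis by blast
  qed

  \<comment> \<open>the three chosen syzygies agree along \<open>H\<^sub>1\<close>, \<open>H\<^sub>2\<close>, \<open>H\<^sub>3\<close>, so they come from one derivation\<close>
  define K where "K s \<longleftrightarrow> combine p Y1 s = combine p Y2 s \<and> combine q Y1 s = combine p Y3 s \<and>
     combine q Y2 s = combine q Y3 s" for s
  have K: "(\<forall>r\<in>UNIV. (\<Sum>i\<in>UNIV. A r i * s i) = 0) \<longleftrightarrow> K s" for s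
  proof -
    have "(\<Sum>i\<in>UNIV. A r i * s i) = 0 \<longleftrightarrow> (\<Sum>i\<in>UNIV. gluing p q r i * s i) = 0" for r
      using E(1)[of r] unfolding rows[symmetric] by simp
    then show ?thesis by (simp add: all_triple_point gluing_sum K_def)
  qed
  have "\<exists>J G. J \<subseteq> UNIV \<and> (\<forall>i\<in>UNIV - J. \<forall>j\<in>J. homog (W j / W i) (G i j)) \<and>
    (\<forall>s. (\<forall>r\<in>UNIV. (\<Sum>i\<in>UNIV. A r i * s i) = 0) \<longleftrightarrow> (\<forall>i\<in>UNIV - J. s i = (\<Sum>j\<in>J. G i j * s j)))"
    by (rule homogeneous_kernel[where \<omega> = "\<lambda>r. 1 / 2 ^ k r"]; rule finite W homog_A onto)
  then obtain J G where ker: "\<And>s. K s \<longleftrightarrow> (\<forall>i\<in>UNIV - J. s i = (\<Sum>j\<in>J. G i j * s j))"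
    unfolding K by (elim exE conjE) (rule that, erule spec)
  have J: "finite J" by (rule finite_subset[OF subset_UNIV finite_triple_point_bool])
  \<comment> \<open>the kernel vector whose free coordinates form the \<open>j\<close>-th unit vector\<close>
  define v where "v j i = (if i \<in> J then (if i = j then 1 else 0) else G i j)" for j i
  have Kv: "K (v j)" if "j \<in> J" for j
    unfolding ker
  proof
    fix i assume i: "i \<in> UNIV - J"
    have "(\<Sum>l\<in>J. G i l * v j l) = (\<Sum>l\<in>J. if l = j then G i l else 0)"
      by (rule sum.cong) (simp_all add: v_def)
    then show "v j i = (\<Sum>l\<in>J. G i l * v j l)" using i J that by (simp add: v_def)
  qed
  have expand: "s i = (\<Sum>j\<in>J. s j * v j i)" if s: "K s" for s i
  proof (cases "i \<in> J")
    case True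
    have "(\<Sum>j\<in>J. s j * v j i) = (\<Sum>j\<in>J. if j = i then s j else 0)"
      by (rule sum.cong) (use True in \<open>simp_all add: v_def\<close>)
    then show ?thesis using True J by simp
  next
    case False
    then have "s i = (\<Sum>j\<in>J. G i j * s j)" using s unfolding ker by blast
    then show ?thesis using False by (simp add: v_def mult.commute)
  qed
  define \<theta> where "\<theta> j = der (combine p Y1 (v j)) (combine q Y1 (v j)) (combine q Y2 (v j))" for j
  have \<theta>: "\<theta> j \<in> D_X3 a m" if "j \<in> J" for j
    using syz_combine[of Y1 "v j"] syz_combine[of Y2 "v j"] syz_combine[of Y3 "v j"] Kv[OF that]
    unfolding D_X3_iff_syzygies K_def by (simp add: \<theta>_def der_in_Der)
  have \<theta>_sum: "(\<Sum>j\<in>J. smul (t j) (\<theta> j)) xS = combine p Y1 (\<lambda>i. \<Sum>j\<in>J. t j * v j i)"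
    "(\<Sum>j\<in>J. smul (t j) (\<theta> j)) yS = combine q Y1 (\<lambda>i. \<Sum>j\<in>J. t j * v j i)"
    "(\<Sum>j\<in>J. smul (t j) (\<theta> j)) zS = combine q Y2 (\<lambda>i. \<Sum>j\<in>J. t j * v j i)" for t
    by (simp_all add: sum_smul_apply combine_sum \<theta>_def)
  show ?thesis
  proof (rule free_submoduleI[OF J subspace_D_X3 \<theta>])
    fix t assume 0: "(\<Sum>j\<in>J. smul (t j) (\<theta> j)) = 0"
    define s where "s i = (\<Sum>j\<in>J. t j * v j i)" for i
    have "K s"
      using Kv unfolding K_def s_def combine_sum by (intro conjI sum.cong) auto
    moreover have "combine p Y1 s = 0" "combine q Y1 s = 0" "combine q Y2 s = 0"
      using \<theta>_sum[of t] unfolding 0 s_def[abs_def] by simp_all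
    ultimately have "combine p Y s = 0" "combine q Y s = 0" for Y
      unfolding K_def by (cases Y; simp)+
    then have "s (Y, True) = 0" "s (Y, False) = 0" for Y
      unfolding combine_def by (rule homog_basis_unique[OF basis])+
    then have "s (Y, b) = 0" for Y b by (cases b) simp_all
    then have zero: "s i = 0" for i by (cases i) simp
    show "\<forall>j\<in>J. t j = 0"
    proof
      fix i assume i: "i \<in> J"
      have "s i = (\<Sum>j\<in>J. if j = i then t j else 0)"
        unfolding s_def by (rule sum.cong) (use i in \<open>simp_all add: v_def\<close>)
      then show "t i = 0" using i J zero by simp
    qed
  next
    fix \<psi> assume \<psi>: "\<psi> \<in> D_X3 a m"
    have "\<exists>s. \<forall>Y. combine p Y s = triplewise (\<psi> xS) (\<psi> xS) (\<psi> yS) Y \<and>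
        combine q Y s = triplewise (\<psi> yS) (\<psi> zS) (\<psi> zS) Y"
    proof (rule coordinates)
      show "syzygy a m Y (triplewise (\<psi> xS) (\<psi> xS) (\<psi> yS) Y) (triplewise (\<psi> yS) (\<psi> zS) (\<psi> zS) Y)" for Y
        using \<psi> unfolding D_X3_iff_syzygies by (cases Y) (simp_all add: triplewise_def)
    qed
    then obtain s where s: "\<And>Y. combine p Y s = triplewise (\<psi> xS) (\<psi> xS) (\<psi> yS) Y"
        "\<And>Y. combine q Y s = triplewise (\<psi> yS) (\<psi> zS) (\<psi> zS) Y"
      by blast
    then have "K s" by (simp add: K_def triplewise_def)
    then have "(\<lambda>i. \<Sum>j\<in>J. s j * v j i) = s" using expand by (simp add: fun_eq_iff)
    then have gens: "(\<Sum>j\<in>J. smul (s j) (\<theta> j)) xS = \<psi> xS" "(\<Sum>j\<in>J. smul (s j) (\<theta> j)) yS = \<psi> yS"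
      "(\<Sum>j\<in>J. smul (s j) (\<theta> j)) zS = \<psi> zS"
      unfolding \<theta>_sum by (simp_all add: s triplewise_def)
    have "(\<Sum>j\<in>J. smul (s j) (\<theta> j)) \<in> D_X3 a m"
      using \<theta> by (intro module.subspace_sum[OF module_smul subspace_D_X3]
        module.subspace_scale[OF module_smul subspace_D_X3])
    then have "\<psi> f = (\<Sum>j\<in>J. smul (s j) (\<theta> j)) f" for f
      using Der_eq_der[of \<psi> f] Der_eq_der[of "\<Sum>j\<in>J. smul (s j) (\<theta> j)" f] \<psi>
      by (simp add: D_X3_iff gens)
    then show "\<exists>t. \<psi> = (\<Sum>j\<in>J. smul (t j) (\<theta> j))" by (metis ext)
  qed
qed

theorem proposition3p4:
  fixes a :: "'a::field_char_0" and m :: "plane \<Rightarrow> nat"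
  assumes "a \<noteq> 0" and "a \<noteq> 1" and "\<forall>H. m H > 0"
  shows "free_submodule smul (D_X3 a m) \<longleftrightarrow> cohomology2 a m = {cohomology2_zero a m}"
  unfolding cohomology2_trivial_iff
  using free_imp_cohomology2_trivial[OF assms] cohomology2_trivial_imp_free[OF assms(1)] by blast

end
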